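(* Let $X\subseteq\omega$ be an oracle with $X\geq_T \emptyset'$. (a) There are equivalence relations $E_i$ ($i\in\omega$) on $\omega$ such that each $E_i$ is minimal, the $E_i$ are pairwise $\leq_c$-incomparable, and $E_i\in\Sigma^0_1(X)\setminus\Pi^0_1(X)$ for every $i$. (b) There are equivalence relations $F_i$ ($i\in\omega$) on $\omega$ such that each $F_i$ is minimal, the $F_i$ are pairwise $\leq_c$-incomparable, and $F_i\in\Pi^0_1(X)\setminus\Sigma^0_1(X)$ for every $i$. Furthermore, these can be chosen so that for every $i\in\omega$, every $E_i$-equivalence class and every $F_i$-equivalence class is computably enumerable.
   Context: All equivalence relations have domain $\omega$. For equivalence relations $R,S$, $R\leq_c S$ ($R$ is computably reducible to $S$) means there is a computable function $f$ with $xRy\Leftrightarrow f(x)Sf(y)$ for all $x,y$; $R\equiv_c S$ means $R\leq_c S$ and $S\leq_c R$. For $n\geq 1$, $\mathrm{Id}_n$ is the relation $x\,\mathrm{Id}_n\,y \Leftrightarrow n\mid (x-y)$. An equivalence relation $R$ is minimal if it has infinitely many classes and for every equivalence relation $E$, $E\leq_c R$ implies $E\equiv_c R$ or $E\equiv_c \mathrm{Id}_n$ for some $n$. $\Sigma^0_1(X)$ (resp. $\Pi^0_1(X)$) denotes the sets (here, sets of pairs) that are c.e. relative to $X$ (resp. co-c.e. relative to $X$). *)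

theory Defs
  imports Main "HOL-Library.Nat_Bijection"
begin

text \<open>Programs: Kleene mu-recursive function terms, plus an oracle-call primitive.
  Arguments are passed as lists of naturals; missing arguments read as 0.\<close>

datatype recf = Zero | Succ | Proj nat | Comp recf "recf list" | Prim recf recf | Mn recf | Orc

definition arg :: "nat \<Rightarrow> nat list \<Rightarrow> nat" where
  "arg i xs = (if i < length xs then xs ! i else 0)"

inductive eval :: "(nat \<Rightarrow> nat) \<Rightarrow> recf \<Rightarrow> nat list \<Rightarrow> nat \<Rightarrow> bool" for orc where
  ev_zero: "eval orc Zero xs 0"
| ev_succ: "eval orc Succ xs (Suc (arg 0 xs))"
| ev_proj: "eval orc (Proj i) xs (arg i xs)"
| ev_orc:  "eval orc Orc xs (orc (arg 0 xs))"
| ev_comp: "list_all2 (\<lambda>g z. eval orc g xs z) gs zs \<Longrightarrow> eval orc f zs y \<Longrightarrow> eval orc (Comp f gs) xs y"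
| ev_prim0: "eval orc f xs y \<Longrightarrow> eval orc (Prim f g) (0 # xs) y"
| ev_primS: "eval orc (Prim f g) (n # xs) z \<Longrightarrow> eval orc g (z # n # xs) y \<Longrightarrow> eval orc (Prim f g) (Suc n # xs) y"
| ev_mn: "eval orc f (n # xs) 0 \<Longrightarrow> (\<forall>m<n. \<exists>k. eval orc f (m # xs) (Suc k)) \<Longrightarrow> eval orc (Mn f) xs n"

primrec enc :: "recf \<Rightarrow> nat" where
  "enc Zero = prod_encode (0, 0)"
| "enc Succ = prod_encode (1, 0)"
| "enc (Proj i) = prod_encode (2, i)"
| "enc (Comp f gs) = prod_encode (3, prod_encode (enc f, list_encode (map enc gs)))"
| "enc (Prim f g) = prod_encode (4, prod_encode (enc f, enc g))"
| "enc (Mn f) = prod_encode (5, enc f)"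
| "enc Orc = prod_encode (6, 0)"

definition chi :: "nat set \<Rightarrow> nat \<Rightarrow> nat" where
  "chi A n = (if n \<in> A then 1 else 0)"

definition empty_oracle :: "nat \<Rightarrow> nat" where
  "empty_oracle = chi {}"

definition halting_set :: "nat set" where
  "halting_set = {enc p | p. \<exists>y. eval empty_oracle p [enc p] y}"

definition computable :: "(nat \<Rightarrow> nat) \<Rightarrow> bool" where
  "computable f \<longleftrightarrow> (\<exists>p. \<forall>x. eval empty_oracle p [x] (f x))"

definition turing_reducible :: "nat set \<Rightarrow> nat set \<Rightarrow> bool" where
  "turing_reducible A X \<longleftrightarrow> (\<exists>p. \<forall>x. eval (chi X) p [x] (chi A x))"

definition ce :: "nat set \<Rightarrow> bool" where
  "ce A \<longleftrightarrow> (\<exists>p. \<forall>x. x \<in> A \<longleftrightarrow> (\<exists>y. eval empty_oracle p [x] y))"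

definition Sigma01 :: "nat set \<Rightarrow> (nat \<times> nat) set \<Rightarrow> bool" where
  "Sigma01 X R \<longleftrightarrow> (\<exists>p. \<forall>x y. (x, y) \<in> R \<longleftrightarrow> (\<exists>z. eval (chi X) p [x, y] z))"

definition Pi01 :: "nat set \<Rightarrow> (nat \<times> nat) set \<Rightarrow> bool" where
  "Pi01 X R \<longleftrightarrow> Sigma01 X (- R)"

definition creduc :: "(nat \<times> nat) set \<Rightarrow> (nat \<times> nat) set \<Rightarrow> bool" where
  "creduc R S \<longleftrightarrow> (\<exists>f. computable f \<and> (\<forall>x y. (x, y) \<in> R \<longleftrightarrow> (f x, f y) \<in> S))"

definition cequiv :: "(nat \<times> nat) set \<Rightarrow> (nat \<times> nat) set \<Rightarrow> bool" where
  "cequiv R S \<longleftrightarrow> creduc R S \<and> creduc S R"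

definition Id_mod :: "nat \<Rightarrow> (nat \<times> nat) set" where
  "Id_mod n = {(x, y). int n dvd (int x - int y)}"

definition minimal_er :: "(nat \<times> nat) set \<Rightarrow> bool" where
  "minimal_er R \<longleftrightarrow> infinite (UNIV // R) \<and>
     (\<forall>E. equiv UNIV E \<longrightarrow> creduc E R \<longrightarrow> (cequiv E R \<or> (\<exists>n\<ge>1. cequiv E (Id_mod n))))"

end

theory Submission
  imports Defs
begin

text \<open>A finite injury argument builds a ceer \<open>S\<close> with classes numbered \<open>0, 1, 2, \<dots>\<close> in the order of
  their least elements (\<open>idx x\<close> is the number of the class of \<open>x\<close>) such that every c.e. relation \<open>V\<close>
  has a bound \<open>e\<close> as follows: for each \<open>m\<close>, either \<open>V\<close> relates two elements of class \<open>m\<close>, or it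
  relates elements of class \<open>m\<close> only to classes \<open>\<le> max m e\<close>.  With \<open>V = \<omega> \<times> range f\<close>
  this says that a c.e. set meeting infinitely many classes meets all of them, so every
  equivalence relation with infinitely many classes that contains \<open>S\<close> reduces to its restriction to such a set;
  if moreover all its classes are c.e., it is minimal.  This applies to the relation \<open>R A\<close> that merges the classes
  \<open>2 k\<close> and \<open>2 k + 1\<close> for \<open>k \<in> A\<close>.  Since \<open>idx\<close> is computable in the halting problem, \<open>R A\<close> has the
  same complexity relative to \<open>X\<close> as \<open>A\<close>.  With \<open>V\<close> the graph of a reduction from \<open>R A\<close> to \<open>R B\<close>, or its
  converse, the dichotomy shows that \<open>B - A\<close> is finite.  So it suffices to take for \<open>A\<close> disjoint copies of the
  halting problem relative to \<open>X\<close>, and their complements.\<close>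


section \<open>Determinism of evaluation\<close>

inductive_cases eval_ZeroE: "eval orc Zero xs y"
inductive_cases eval_SuccE: "eval orc Succ xs y"
inductive_cases eval_ProjE: "eval orc (Proj i) xs y"
inductive_cases eval_OrcE: "eval orc Orc xs y"
inductive_cases eval_CompE: "eval orc (Comp f gs) xs y"
inductive_cases eval_PrimE: "eval orc (Prim f g) xs y"
inductive_cases eval_MnE: "eval orc (Mn f) xs y"

lemma eval_deterministic: "eval orc p xs y \<Longrightarrow> eval orc p xs y' \<Longrightarrow> y = y'"
proof (induction arbitrary: y' rule: eval.induct)
  case (ev_comp xs gs zs f y)
  from ev_comp.prems obtain zs' where zs': "list_all2 (\<lambda>g z. eval orc g xs z) gs zs'" "eval orc f zs' y'"
    by (auto elim: eval_CompE)
  have "zs = zs'"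
    using ev_comp.IH(1) zs'(1) by (auto simp: list_all2_conv_all_nth intro!: nth_equalityI)
  then show ?case using ev_comp.IH(2) zs'(2) by blast
next
  case (ev_prim0 f xs y g)
  from ev_prim0.prems have "eval orc f xs y'" by (auto elim: eval_PrimE)
  then show ?case by (rule ev_prim0.IH)
next
  case (ev_primS f g n xs z y)
  from ev_primS.prems obtain z' where "eval orc (Prim f g) (n # xs) z'" "eval orc g (z' # n # xs) y'"
    by (auto elim: eval_PrimE)
  then show ?case using ev_primS.IH by blast
next
  case (ev_mn f n xs)
  from ev_mn.prems have y': "eval orc f (y' # xs) 0" "\<forall>m<y'. \<exists>k. eval orc f (m # xs) (Suc k)"
    by (auto elim: eval_MnE)
  show ?case
  proof (rule linorder_cases[of n y'])
    assume "n < y'"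
    then show ?thesis using y'(2) ev_mn.IH(1) by blast
  next
    assume "y' < n"
    then obtain k where "\<forall>z. eval orc f (y' # xs) z \<longrightarrow> Suc k = z" using ev_mn.IH(2) by blast
    then show ?thesis using y'(1) by blast
  qed
qed (auto elim: eval_ZeroE eval_SuccE eval_ProjE eval_OrcE)

text \<open>Totality of \<open>f\<close> turns the side condition of \<open>ev_mn\<close> into a
  condition on values. The equivalence also says when the search diverges, which semidecision
  needs.\<close>

lemma eval_Mn_iff:
  assumes "\<And>n. eval orc f (n # xs) (F n)"
  shows "eval orc (Mn f) xs n \<longleftrightarrow> F n = 0 \<and> (\<forall>m<n. F m \<noteq> 0)"
proof
  assume "eval orc (Mn f) xs n"
  then have "eval orc f (n # xs) 0" "\<forall>m<n. \<exists>k. eval orc f (m # xs) (Suc k)"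
    by (auto elim: eval_MnE)
  then show "F n = 0 \<and> (\<forall>m<n. F m \<noteq> 0)"
    by (metis assms eval_deterministic nat.distinct(1))
next
  assume *: "F n = 0 \<and> (\<forall>m<n. F m \<noteq> 0)"
  then show "eval orc (Mn f) xs n"
    by (intro ev_mn) (metis assms, metis assms not0_implies_Suc)
qed

subsection \<open>Primitive programs\<close>

text \<open>Lists of every length are allowed, so compositions carry no arity conditions;
  \<open>arg\<close> supplies zeros.\<close>

definition computes :: "(nat \<Rightarrow> nat) \<Rightarrow> recf \<Rightarrow> (nat list \<Rightarrow> nat) \<Rightarrow> bool" where
  "computes orc p F \<longleftrightarrow> (\<forall>xs. eval orc p xs (F xs))"

lemma arg_0 [simp]: "arg 0 (x # xs) = x"
  and arg_Suc [simp]: "arg (Suc i) (x # xs) = arg i xs"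
  by (auto simp: arg_def)

lemma computes_basic:
  "computes orc Zero (\<lambda>xs. 0)"
  "computes orc Succ (\<lambda>xs. Suc (arg 0 xs))"
  "computes orc (Proj i) (\<lambda>xs. arg i xs)"
  "computes orc Orc (\<lambda>xs. orc (arg 0 xs))"
  by (auto simp: computes_def intro: eval.intros)

lemma computes_Comp1:
  "computes orc f F \<Longrightarrow> computes orc g G \<Longrightarrow> computes orc (Comp f [g]) (\<lambda>xs. F [G xs])"
  by (auto simp: computes_def intro!: ev_comp)

lemma computes_Comp2:
  "computes orc f F \<Longrightarrow> computes orc g G \<Longrightarrow> computes orc h H \<Longrightarrow>
    computes orc (Comp f [g, h]) (\<lambda>xs. F [G xs, H xs])"
  unfolding computes_def by (blast intro: ev_comp list_all2_Cons[THEN iffD2] list_all2_Nil[THEN iffD2])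

lemma eval_Prim_Cons:
  assumes "eval orc f xs a" "\<And>n r. eval orc g (r # n # xs) (G n r)"
  shows "eval orc (Prim f g) (n # xs) (rec_nat a G n)"
  by (induction n) (auto intro: assms ev_prim0 ev_primS)

text \<open>\<open>Prim\<close> has no value on the empty list, so two projections first rebuild the
  arguments as a list of length two. The result is total again.\<close>

lemma computes_Prim:
  assumes "computes orc f F" "computes orc g G"
  shows "computes orc (Comp (Prim f g) [Proj 0, Proj 1])
    (\<lambda>xs. rec_nat (F [arg 1 xs]) (\<lambda>n r. G [r, n, arg 1 xs]) (arg 0 xs))"
  unfolding computes_def
proof
  fix xs
  have "eval orc (Prim f g) [arg 0 xs, arg 1 xs]
      (rec_nat (F [arg 1 xs]) (\<lambda>n r. G [r, n, arg 1 xs]) (arg 0 xs))"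
    using assms by (intro eval_Prim_Cons) (auto simp: computes_def)
  moreover have "list_all2 (\<lambda>g z. eval orc g xs z) [Proj 0, Proj 1] [arg 0 xs, arg 1 xs]"
    by (auto intro: ev_proj)
  ultimately show "eval orc (Comp (Prim f g) [Proj 0, Proj 1]) xs
      (rec_nat (F [arg 1 xs]) (\<lambda>n r. G [r, n, arg 1 xs]) (arg 0 xs))"
    by (rule ev_comp[rotated])
qed

lemma computes_add: "\<exists>p. computes orc p (\<lambda>xs. arg 0 xs + arg 1 xs)"
proof -
  have "rec_nat y (\<lambda>n r. Suc r) x = x + y" for x y :: nat by (induction x) auto
  then show ?thesis using computes_Prim[OF computes_basic(3)[of orc 0] computes_basic(2)[of orc]]
    by (auto intro!: exI)
qed

lemma computes_sub: "\<exists>p. computes orc p (\<lambda>xs. arg 0 xs - arg 1 xs)"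
proof -
  have "rec_nat 0 (\<lambda>n r. n) x = x - 1" for x :: nat by (cases x) auto
  then obtain pd where pd: "computes orc pd (\<lambda>xs. arg 0 xs - 1)"
    using computes_Prim[OF computes_basic(1)[of orc] computes_basic(3)[of orc 1]]
    by auto
  \<comment> \<open>The recursion runs on the subtrahend; the swapped arguments are exchanged
    afterwards.\<close>
  have "rec_nat y (\<lambda>n r. r - 1) x = y - x" for x y :: nat by (induction x) auto
  then obtain sb where sb: "computes orc sb (\<lambda>xs. arg 1 xs - arg 0 xs)"
    using computes_Prim[OF computes_basic(3)[of orc 0] pd] by auto
  from computes_Comp2[OF sb computes_basic(3)[of orc 1] computes_basic(3)[of orc 0]]
  show ?thesis by auto
qed

lemma computes_triangle: "\<exists>p. computes orc p (\<lambda>xs. triangle (arg 0 xs))"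
proof -
  obtain ad where ad: "computes orc ad (\<lambda>xs. arg 0 xs + arg 1 xs)" using computes_add[of orc] by (rule exE)
  have "rec_nat 0 (\<lambda>n r. r + Suc n) x = triangle x" for x :: nat by (induction x) auto
  with computes_Prim[OF computes_basic(1)[of orc] computes_Comp2[OF ad computes_basic(3)[of orc 0]
      computes_Comp1[OF computes_basic(2) computes_basic(3)[of orc 1]]]]
  show ?thesis by auto
qed

lemma computes_prod_encode: "\<exists>p. computes orc p (\<lambda>xs. prod_encode (arg 0 xs, arg 1 xs))"
proof -
  obtain ad where ad: "computes orc ad (\<lambda>xs. arg 0 xs + arg 1 xs)" using computes_add[of orc] by (rule exE)
  obtain tr where tr: "computes orc tr (\<lambda>xs. triangle (arg 0 xs))" using computes_triangle[of orc] by (rule exE)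
  from computes_Comp2[OF ad computes_Comp1[OF tr ad] computes_basic(3)[of orc 0]]
  show ?thesis by (auto simp: prod_encode_def)
qed

lemma triangle_mono: "m \<le> n \<Longrightarrow> triangle m \<le> triangle n"
  unfolding triangle_def by (intro div_le_mono mult_le_mono) auto

text \<open>The diagonal that contains \<^term>\<open>z\<close> in the Cantor pairing is the least \<^term>\<open>w\<close> with
  \<^term>\<open>z < triangle (Suc w)\<close>; this is how \<^const>\<open>prod_decode\<close> is inverted by minimisation.\<close>

lemma computes_diagonal:
  "\<exists>p. computes orc p (\<lambda>xs. fst (prod_decode (arg 0 xs)) + snd (prod_decode (arg 0 xs)))"
proof -
  obtain tr where tr: "computes orc tr (\<lambda>xs. triangle (arg 0 xs))" using computes_triangle[of orc] by (rule exE)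
  obtain sb where sb: "computes orc sb (\<lambda>xs. arg 0 xs - arg 1 xs)" using computes_sub[of orc] by (rule exE)
  let ?F = "\<lambda>w z. Suc z - triangle (Suc w)"
  obtain q where q: "computes orc q (\<lambda>xs. ?F (arg 0 xs) (arg 1 xs))"
    using computes_Comp2[OF sb computes_Comp1[OF computes_basic(2) computes_basic(3)[of orc 1]]
        computes_Comp1[OF tr computes_basic(2)]] by auto
  have "eval orc (Mn q) [z] (fst (prod_decode z) + snd (prod_decode z))" for z
  proof -
    obtain a b where ab: "prod_decode z = (a, b)" by (cases "prod_decode z")
    then have "z = prod_encode (a, b)" by (metis prod_decode_inverse)
    then have z: "z = triangle (a + b) + a" by (simp add: prod_encode_def)
    have "eval orc q [n, z] (?F n z)" for n using q[unfolded computes_def, rule_format, of "[n, z]"] by simp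
    then have "eval orc (Mn q) [z] (a + b) \<longleftrightarrow> ?F (a + b) z = 0 \<and> (\<forall>m<a + b. ?F m z \<noteq> 0)"
      by (rule eval_Mn_iff)
    moreover have "Suc z - triangle (Suc m) \<noteq> 0" if "m < a + b" for m
    proof -
      have "triangle (Suc m) \<le> triangle (a + b)" using that by (intro triangle_mono) auto
      then show ?thesis using z by linarith
    qed
    moreover have "Suc z - triangle (Suc (a + b)) = 0" using z by simp
    ultimately show ?thesis using ab by simp
  qed
  then have "eval orc (Comp (Mn q) [Proj 0]) xs (fst (prod_decode (arg 0 xs)) + snd (prod_decode (arg 0 xs)))" for xs
    by (intro ev_comp[of _ _ _ "[arg 0 xs]"]) (auto intro: ev_proj)
  then show ?thesis unfolding computes_def by blast
qed

lemma computes_fst: "\<exists>p. computes orc p (\<lambda>xs. fst (prod_decode (arg 0 xs)))"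
  and computes_snd: "\<exists>p. computes orc p (\<lambda>xs. snd (prod_decode (arg 0 xs)))"
proof -
  obtain tr where tr: "computes orc tr (\<lambda>xs. triangle (arg 0 xs))" using computes_triangle[of orc] by (rule exE)
  obtain sb where sb: "computes orc sb (\<lambda>xs. arg 0 xs - arg 1 xs)" using computes_sub[of orc] by (rule exE)
  obtain dg where dg: "computes orc dg (\<lambda>xs. fst (prod_decode (arg 0 xs)) + snd (prod_decode (arg 0 xs)))"
    using computes_diagonal[of orc] by (rule exE)
  \<comment> \<open>Since \<open>prod_encode (a, b) = triangle (a + b) + a\<close>, the diagonal
    gives \<open>a\<close> by subtraction, and then \<open>b\<close>.\<close>
  have *: "z - triangle (fst (prod_decode z) + snd (prod_decode z)) = fst (prod_decode z)" for z
  proof (cases "prod_decode z")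
    case p: (Pair a b)
    then have "z = prod_encode (a, b)" by (metis prod_decode_inverse)
    then have "z - triangle (a + b) = a" by (simp add: prod_encode_def)
    then show ?thesis by (simp only: p fst_conv snd_conv)
  qed
  from computes_Comp2[OF sb computes_basic(3)[of orc 0] computes_Comp1[OF tr dg]]
  obtain f where f: "computes orc f (\<lambda>xs. fst (prod_decode (arg 0 xs)))" by (auto simp: *)
  then show "\<exists>p. computes orc p (\<lambda>xs. fst (prod_decode (arg 0 xs)))" by blast
  from computes_Comp2[OF sb dg f]
  show "\<exists>p. computes orc p (\<lambda>xs. snd (prod_decode (arg 0 xs)))" by auto
qed

subsection \<open>Computability on encoded types\<close>

text \<open>With a bijection every number is a code: \<open>decode\<close> is total and, like
  \<open>encode\<close>, acts as the identity on codes, and searches may range over all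
  numbers.\<close>

class encodable =
  fixes encode :: "'a \<Rightarrow> nat"
  assumes bij_encode: "bij encode"
begin

lemma encode_inject [simp]: "encode x = encode y \<longleftrightarrow> x = y"
  using bij_encode by (auto simp: bij_def inj_def)

definition decode :: "nat \<Rightarrow> 'a" where
  "decode = inv encode"

lemma encode_decode [simp]: "encode (decode n) = n"
  using bij_encode by (simp add: decode_def bij_is_surj surj_f_inv_f)

lemma decode_encode [simp]: "decode (encode x) = x"
  using bij_encode by (simp add: decode_def bij_is_inj)

end

instantiation nat :: encodable
begin

definition encode_nat_def [simp]: "encode (n :: nat) = n"

instance
  by standard (simp add: bij_def inj_def surj_def)

end

instantiation prod :: (encodable, encodable) encodable
begin

definition encode_prod_def: "encode p = prod_encode (encode (fst p), encode (snd p))"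

instance
proof
  have "bij (map_prod (encode :: 'a \<Rightarrow> nat) (encode :: 'b \<Rightarrow> nat))"
  proof (rule o_bij)
    show "map_prod decode decode \<circ> map_prod (encode :: 'a \<Rightarrow> nat) (encode :: 'b \<Rightarrow> nat) = id"
      "map_prod (encode :: 'a \<Rightarrow> nat) (encode :: 'b \<Rightarrow> nat) \<circ> map_prod decode decode = id"
      by (simp_all add: fun_eq_iff)
  qed
  then have "bij (prod_encode \<circ> map_prod (encode :: 'a \<Rightarrow> nat) (encode :: 'b \<Rightarrow> nat))"
    by (rule bij_comp[OF _ bij_prod_encode])
  moreover have "(encode :: 'a \<times> 'b \<Rightarrow> nat) = prod_encode \<circ> map_prod encode encode"
    by (auto simp: encode_prod_def fun_eq_iff)
  ultimately show "bij (encode :: 'a \<times> 'b \<Rightarrow> nat)"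
    by (simp only:)
qed

end

instantiation list :: (encodable) encodable
begin

definition encode_list_def: "encode xs = list_encode (map encode xs)"

instance
proof
  have "bij (map (encode :: 'a \<Rightarrow> nat))"
  proof (rule o_bij)
    show "map decode \<circ> map (encode :: 'a \<Rightarrow> nat) = id" "map (encode :: 'a \<Rightarrow> nat) \<circ> map decode = id"
      by (simp_all add: fun_eq_iff map_idI)
  qed
  then have "bij (list_encode \<circ> map (encode :: 'a \<Rightarrow> nat))"
    by (rule bij_comp[OF _ bij_list_encode])
  moreover have "(encode :: 'a list \<Rightarrow> nat) = list_encode \<circ> map encode"
    by (auto simp: encode_list_def fun_eq_iff)
  ultimately show "bij (encode :: 'a list \<Rightarrow> nat)"
    by (simp only:)
qed

end

lemma encode_Nil [simp]: "encode [] = 0"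
  and encode_Cons [simp]: "encode (x # xs) = Suc (prod_encode (encode x, encode xs))"
  by (simp_all add: encode_list_def)

lemma encode_Pair [simp]: "encode (x, y) = prod_encode (encode x, encode y)"
  by (simp add: encode_prod_def)

definition computable_in :: "(nat \<Rightarrow> nat) \<Rightarrow> ('a::encodable \<Rightarrow> 'b::encodable) \<Rightarrow> bool" where
  "computable_in orc f \<longleftrightarrow> (\<exists>p. \<forall>x. eval orc p [encode x] (encode (f x)))"

text \<open>Truth values go through \<open>nat\<close>, since the finite type \<open>bool\<close>
  has no bijection with the numbers.\<close>

definition decidable_in :: "(nat \<Rightarrow> nat) \<Rightarrow> ('a::encodable \<Rightarrow> bool) \<Rightarrow> bool" where
  "decidable_in orc P \<longleftrightarrow> computable_in orc (\<lambda>x. of_bool (P x) :: nat)"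

named_theorems comp_intros

lemma computable_in_program1:
  assumes "\<exists>p. computes orc p (\<lambda>xs. G (arg 0 xs))" "computable_in orc f"
    and "\<And>x. encode (h x) = G (encode (f x))"
  shows "computable_in orc h"
proof -
  obtain p q where p: "\<And>xs. eval orc p xs (G (arg 0 xs))" and q: "\<And>x. eval orc q [encode x] (encode (f x))"
    using assms unfolding computable_in_def computes_def by auto
  have "eval orc p [encode (f x)] (encode (h x))" for x
    using p[of "[encode (f x)]"] assms(3) by simp
  then have "eval orc (Comp p [q]) [encode x] (encode (h x))" for x
    by (intro ev_comp[of _ _ _ "[encode (f x)]"]) (use q in auto)
  then show ?thesis unfolding computable_in_def by blast
qed

lemma computable_in_program2:
  assumes "\<exists>p. computes orc p (\<lambda>xs. G (arg 0 xs) (arg 1 xs))" "computable_in orc f" "computable_in orc g"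
    and "\<And>x. encode (h x) = G (encode (f x)) (encode (g x))"
  shows "computable_in orc h"
proof -
  obtain p q r where p: "\<And>xs. eval orc p xs (G (arg 0 xs) (arg 1 xs))"
    and q: "\<And>x. eval orc q [encode x] (encode (f x))"
    and r: "\<And>x. eval orc r [encode x] (encode (g x))"
    using assms unfolding computable_in_def computes_def by auto
  have "eval orc p [encode (f x), encode (g x)] (encode (h x))" for x
    using p[of "[encode (f x), encode (g x)]"] assms(4) by simp
  then have "eval orc (Comp p [q, r]) [encode x] (encode (h x))" for x
    by (intro ev_comp[of _ _ _ "[encode (f x), encode (g x)]"]) (use q r in auto)
  then show ?thesis unfolding computable_in_def by blast
qed

lemma computable_in_id [comp_intros]: "computable_in orc (\<lambda>x :: 'a::encodable. x)"
proof -
  have "eval orc (Proj 0) [encode x] (encode x)" for x :: 'a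
    using ev_proj[of orc 0 "[encode x]"] by simp
  then show ?thesis unfolding computable_in_def by blast
qed

lemma computes_const: "\<exists>p. computes orc p (\<lambda>xs. c)"
proof (induction c)
  case (Suc c)
  then obtain p where "computes orc p (\<lambda>xs. c)" ..
  from computes_Comp1[OF computes_basic(2) this] show ?case by auto
qed (auto intro: computes_basic)

lemma computable_in_const [comp_intros]: "computable_in orc (\<lambda>x. c)"
  using computable_in_program1[OF computes_const computable_in_id, where h="\<lambda>x. c"] by blast

lemma computable_in_compose:
  assumes "computable_in orc f" "computable_in orc g"
  shows "computable_in orc (\<lambda>x. f (g x))"
proof -
  obtain p q where p: "\<And>x. eval orc p [encode x] (encode (f x))" and q: "\<And>x. eval orc q [encode x] (encode (g x))"
    using assms unfolding computable_in_def by auto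
  have "eval orc (Comp p [q]) [encode x] (encode (f (g x)))" for x
    by (intro ev_comp[of _ _ _ "[encode (g x)]"]) (use p q in auto)
  then show ?thesis unfolding computable_in_def by blast
qed

lemma computable_in_Pair [comp_intros]:
  "computable_in orc f \<Longrightarrow> computable_in orc g \<Longrightarrow> computable_in orc (\<lambda>x. (f x, g x))"
  by (rule computable_in_program2[OF computes_prod_encode]) auto

lemma computable_in_fst [comp_intros]: "computable_in orc f \<Longrightarrow> computable_in orc (\<lambda>x. fst (f x))"
  by (rule computable_in_program1[OF computes_fst]) (auto simp: encode_prod_def)

lemma computable_in_snd [comp_intros]: "computable_in orc f \<Longrightarrow> computable_in orc (\<lambda>x. snd (f x))"
  by (rule computable_in_program1[OF computes_snd]) (auto simp: encode_prod_def)

lemma computable_in_Suc [comp_intros]: "computable_in orc f \<Longrightarrow> computable_in orc (\<lambda>x. Suc (f x))"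
  by (rule computable_in_program1[OF exI, OF computes_basic(2)]) auto

lemma computable_in_orc [comp_intros]: "computable_in orc f \<Longrightarrow> computable_in orc (\<lambda>x. orc (f x))"
  by (rule computable_in_program1[OF exI, OF computes_basic(4)]) auto

lemma computable_in_plus [comp_intros]:
  fixes f g :: "_ \<Rightarrow> nat"
  shows "computable_in orc f \<Longrightarrow> computable_in orc g \<Longrightarrow> computable_in orc (\<lambda>x. f x + g x)"
  by (rule computable_in_program2[where G="(+)" and f=f and g=g, OF computes_add]) auto

lemma computable_in_minus [comp_intros]:
  fixes f g :: "_ \<Rightarrow> nat"
  shows "computable_in orc f \<Longrightarrow> computable_in orc g \<Longrightarrow> computable_in orc (\<lambda>x. f x - g x)"
  by (rule computable_in_program2[where G="(-)" and f=f and g=g, OF computes_sub]) auto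

lemma computable_in_encode [comp_intros]: "computable_in orc f \<Longrightarrow> computable_in orc (\<lambda>x. encode (f x))"
  by (simp add: computable_in_def)

lemma computable_in_decode [comp_intros]: "computable_in orc f \<Longrightarrow> computable_in orc (\<lambda>x. decode (f x))"
  by (simp add: computable_in_def)

lemma prod_decode_eq_decode: "prod_decode = decode"
proof
  fix n
  have "encode (prod_decode n) = n" by (simp add: encode_prod_def)
  then show "prod_decode n = decode n" by (metis decode_encode)
qed

lemma list_decode_eq_decode: "list_decode = decode"
proof
  fix n
  have "encode (list_decode n) = n" by (simp add: encode_list_def map_idI)
  then show "list_decode n = decode n" by (metis decode_encode)
qed

lemma computable_in_prod_decode [comp_intros]:
    "computable_in orc f \<Longrightarrow> computable_in orc (\<lambda>x. prod_decode (f x))"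
  and computable_in_list_decode [comp_intros]:
    "computable_in orc f \<Longrightarrow> computable_in orc (\<lambda>x. list_decode (f x))"
  by (simp_all add: prod_decode_eq_decode list_decode_eq_decode computable_in_decode)

lemma computable_in_prod_encode [comp_intros]:
  "computable_in orc f \<Longrightarrow> computable_in orc (\<lambda>x. prod_encode (f x))"
  by (simp add: computable_in_def encode_prod_def)

lemma computable_in_rec_nat [comp_intros]:
  fixes a :: "'a::encodable \<Rightarrow> 'b::encodable"
  assumes a: "computable_in orc a"
    and g: "computable_in orc (\<lambda>q. g (fst q) (fst (snd q)) (snd (snd q)))"
    and N: "computable_in orc N"
  shows "computable_in orc (\<lambda>x. rec_nat (a x) (g x) (N x))"
proof -
  obtain pa pN where pa: "\<And>x. eval orc pa [encode x] (encode (a x))"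
    and pN: "\<And>x. eval orc pN [encode x] (N x)"
    using assms unfolding computable_in_def by auto
  obtain pg where "\<And>q :: 'a \<times> nat \<times> 'b. eval orc pg [encode q] (encode (g (fst q) (fst (snd q)) (snd (snd q))))"
    using g unfolding computable_in_def by blast
  from this[of "(x, n, r)" for x n r]
  have pg: "eval orc pg [prod_encode (encode x, prod_encode (n, encode r))] (encode (g x n r))" for x n r
    by simp
  obtain pr where pr: "computes orc pr (\<lambda>xs. prod_encode (arg 0 xs, arg 1 xs))"
    using computes_prod_encode[of orc] by (rule exE)
  \<comment> \<open>\<open>Prim\<close> hands its step program the list \<open>[r, n, x]\<close>,
    but \<open>pg\<close> expects one coded triple \<open>(x, n, r)\<close>.\<close>
  define tup where "tup = Comp pr [Proj 2, Comp pr [Proj 1, Proj 0]]"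
  have "computes orc tup (\<lambda>xs. prod_encode (arg 2 xs, prod_encode (arg 1 xs, arg 0 xs)))"
    using computes_Comp2[OF pr computes_basic(3)[of orc 2] computes_Comp2[OF pr computes_basic(3)[of orc 1] computes_basic(3)[of orc 0]]]
    by (simp add: tup_def)
  then have "eval orc tup [r, n, x] (prod_encode (x, prod_encode (n, r)))" for x n r
    by (auto simp: computes_def numeral_2_eq_2 dest: spec[of _ "[r, n, x]"])
  then have step: "eval orc (Comp pg [tup]) [encode r, n, encode x] (encode (g x n r))" for x n r
    by (intro ev_comp[of _ _ _ "[prod_encode (encode x, prod_encode (n, encode r))]"]) (use pg in auto)
  have "eval orc (Prim pa (Comp pg [tup])) [n, encode x] (encode (rec_nat (a x) (g x) n))" for x n
    by (induction n) (auto intro: ev_prim0 ev_primS pa step)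
  then have "eval orc (Comp (Prim pa (Comp pg [tup])) [pN, Proj 0]) [encode x] (encode (rec_nat (a x) (g x) (N x)))" for x
    by (intro ev_comp[of _ _ _ "[N x, encode x]"])
      (use pN ev_proj[of orc 0 "[encode x]"] in auto)
  then show ?thesis unfolding computable_in_def by blast
qed

lemma decidable_in_compose:
  "decidable_in orc P \<Longrightarrow> computable_in orc f \<Longrightarrow> decidable_in orc (\<lambda>x. P (f x))"
  unfolding decidable_in_def by (rule computable_in_compose)

lemma computable_in_if [comp_intros]:
  assumes "decidable_in orc P" "computable_in orc f" "computable_in orc g"
  shows "computable_in orc (\<lambda>x. if P x then f x else g x)"
proof -
  \<comment> \<open>Branching is a recursion of length 0 or 1.\<close>
  have "computable_in orc (\<lambda>x. rec_nat (g x) (\<lambda>_ _. f x) (of_bool (P x)))"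
    using assms(1) unfolding decidable_in_def
    by (intro comp_intros computable_in_compose[OF assms(2)] assms)
  also have "(\<lambda>x. rec_nat (g x) (\<lambda>_ _. f x) (of_bool (P x))) = (\<lambda>x. if P x then f x else g x)"
    by auto
  finally show ?thesis .
qed

lemma decidable_in_const [comp_intros]: "decidable_in orc (\<lambda>x. c)"
  unfolding decidable_in_def by (rule comp_intros)

lemma decidable_in_if [comp_intros]:
  assumes "decidable_in orc P" "decidable_in orc Q" "decidable_in orc R"
  shows "decidable_in orc (\<lambda>x. if P x then Q x else R x)"
proof -
  have "(\<lambda>x. of_bool (if P x then Q x else R x)) = (\<lambda>x. if P x then of_bool (Q x) else of_bool (R x) :: nat)"
    by auto
  then show ?thesis
    using computable_in_if[OF assms(1) assms(2,3)[unfolded decidable_in_def]]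
    by (simp add: decidable_in_def del: of_bool_eq_iff)
qed

lemma decidable_in_not [comp_intros]: "decidable_in orc P \<Longrightarrow> decidable_in orc (\<lambda>x. \<not> P x)"
  using decidable_in_if[OF _ decidable_in_const[of _ False] decidable_in_const[of _ True]] by (simp add: if_bool_eq_conj)

lemma decidable_in_conj [comp_intros]:
  "decidable_in orc P \<Longrightarrow> decidable_in orc Q \<Longrightarrow> decidable_in orc (\<lambda>x. P x \<and> Q x)"
  using decidable_in_if[OF _ _ decidable_in_const[of _ False]] by (simp add: if_bool_eq_disj conj_commute)

lemma decidable_in_disj [comp_intros]:
  "decidable_in orc P \<Longrightarrow> decidable_in orc Q \<Longrightarrow> decidable_in orc (\<lambda>x. P x \<or> Q x)"
  using decidable_in_not[OF decidable_in_conj[OF decidable_in_not decidable_in_not, of orc P Q]] by simp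

lemma decidable_in_eq_0:
  fixes f :: "_ \<Rightarrow> nat"
  assumes "computable_in orc f"
  shows "decidable_in orc (\<lambda>x. f x = 0)"
proof -
  have "computable_in orc (\<lambda>x. 1 - f x)" using assms by (intro comp_intros)
  also have "(\<lambda>x. 1 - f x) = (\<lambda>x. of_bool (f x = 0))" by auto
  finally show ?thesis unfolding decidable_in_def .
qed

lemma decidable_in_le [comp_intros]:
  fixes f g :: "_ \<Rightarrow> nat"
  assumes "computable_in orc f" "computable_in orc g"
  shows "decidable_in orc (\<lambda>x. f x \<le> g x)"
  using decidable_in_eq_0[OF computable_in_minus[OF assms]] by simp

lemma decidable_in_less [comp_intros]:
  fixes f g :: "_ \<Rightarrow> nat"
  assumes "computable_in orc f" "computable_in orc g"
  shows "decidable_in orc (\<lambda>x. f x < g x)"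
  using decidable_in_not[OF decidable_in_le[OF assms(2,1)]] by (simp add: not_le)

lemma decidable_in_eq [comp_intros]:
  fixes f g :: "'a::encodable \<Rightarrow> 'b::encodable"
  assumes "computable_in orc f" "computable_in orc g"
  shows "decidable_in orc (\<lambda>x. f x = g x)"
proof -
  have "decidable_in orc (\<lambda>x. encode (f x) \<le> encode (g x) \<and> encode (g x) \<le> encode (f x))"
    using assms by (intro comp_intros)
  also have "(\<lambda>x. encode (f x) \<le> encode (g x) \<and> encode (g x) \<le> encode (f x)) = (\<lambda>x. f x = g x)"
    by (simp only: order.eq_iff[symmetric] encode_inject)
  finally show ?thesis .
qed

lemma decidable_in_bex_less [comp_intros]:
  assumes P: "decidable_in orc (\<lambda>q :: 'a::encodable \<times> nat. P (fst q) (snd q))" and N: "computable_in orc N"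
  shows "decidable_in orc (\<lambda>x. \<exists>n<N x. P x n)"
proof -
  \<comment> \<open>\<open>?r x n\<close> counts the witnesses below \<open>n\<close>.\<close>
  let ?r = "\<lambda>x n. rec_nat (0 :: nat) (\<lambda>i r. r + of_bool (P x i)) n"
  have "computable_in orc (\<lambda>q :: 'a \<times> nat \<times> nat. of_bool (P (fst q) (fst (snd q))) :: nat)"
    using decidable_in_compose[OF P, of "\<lambda>q. (fst q, fst (snd q))"]
    by (simp add: decidable_in_def comp_intros)
  then have "computable_in orc (\<lambda>x. ?r x (N x))"
    using N by (intro comp_intros)
  then have "decidable_in orc (\<lambda>x. \<not> ?r x (N x) = 0)"
    by (intro decidable_in_not decidable_in_eq_0)
  moreover have "?r x n = 0 \<longleftrightarrow> \<not> (\<exists>i<n. P x i)" for x n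
    by (induction n) (auto simp: less_Suc_eq)
  ultimately show ?thesis by simp
qed

lemma decidable_in_ball_less [comp_intros]:
  assumes "decidable_in orc (\<lambda>q :: 'a::encodable \<times> nat. P (fst q) (snd q))" "computable_in orc N"
  shows "decidable_in orc (\<lambda>x. \<forall>n<N x. P x n)"
  using decidable_in_not[OF decidable_in_bex_less[where P="\<lambda>x n. \<not> P x n", OF decidable_in_not[OF assms(1)] assms(2)]] by simp

text \<open>Minimisation applied to the characteristic function of the negation. Inputs without a
  witness are covered too, so the lemma serves both \<open>LEAST\<close> and semidecision.\<close>

lemma halting_search:
  assumes "decidable_in orc (\<lambda>q :: 'a::encodable \<times> nat. P (fst q) (snd q))"
  shows "\<exists>p. \<forall>x n. eval orc p [encode x] n \<longleftrightarrow> P x n \<and> (\<forall>m<n. \<not> P x m)"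
proof -
  have "computable_in orc (\<lambda>q. of_bool (\<not> P (fst q) (snd q)) :: nat)"
    using decidable_in_not[OF assms] unfolding decidable_in_def .
  then obtain p where "\<And>q :: 'a \<times> nat. eval orc p [encode q] (of_bool (\<not> P (fst q) (snd q)))"
    unfolding computable_in_def encode_nat_def by blast
  from this[of "(x, n)" for x n]
  have p: "eval orc p [prod_encode (encode x, n)] (of_bool (\<not> P x n))" for x n by simp
  obtain pr where pr: "computes orc pr (\<lambda>xs. prod_encode (arg 0 xs, arg 1 xs))"
    using computes_prod_encode[of orc] by (rule exE)
  have "eval orc (Comp pr [Proj 1, Proj 0]) [n, x] (prod_encode (x, n))" for x n
    using computes_Comp2[OF pr computes_basic(3)[of orc 1] computes_basic(3)[of orc 0]]
    by (auto simp: computes_def dest: spec[of _ "[n, x]"])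
  then have "eval orc (Comp p [Comp pr [Proj 1, Proj 0]]) [n, encode x] (of_bool (\<not> P x n))" for x n
    by (intro ev_comp[of _ _ _ "[prod_encode (encode x, n)]"]) (use p in auto)
  from eval_Mn_iff[OF this]
  have "eval orc (Mn (Comp p [Comp pr [Proj 1, Proj 0]])) [encode x] n \<longleftrightarrow> P x n \<and> (\<forall>m<n. \<not> P x m)" for x n
    by simp
  then show ?thesis by blast
qed

lemma computable_in_Least [comp_intros]:
  assumes "decidable_in orc (\<lambda>q :: 'a::encodable \<times> nat. P (fst q) (snd q))" and ex: "\<And>x. \<exists>n. P x n"
  shows "computable_in orc (\<lambda>x. LEAST n. P x n)"
proof -
  obtain p where p: "\<And>x n. eval orc p [encode x] n \<longleftrightarrow> P x n \<and> (\<forall>m<n. \<not> P x m)"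
    using halting_search[OF assms(1)] by blast
  have "eval orc p [encode x] (LEAST n. P x n)" for x
    using ex[of x] p by (meson LeastI_ex not_less_Least)
  then show ?thesis unfolding computable_in_def by auto
qed

section \<open>Computable list operations\<close>

lemma computable_in_Cons [comp_intros]:
  assumes "computable_in orc f" "computable_in orc g"
  shows "computable_in orc (\<lambda>x. f x # g x)"
proof -
  have "computable_in orc (\<lambda>x. Suc (encode (f x, g x)))" using assms by (intro comp_intros)
  then show ?thesis by (simp add: computable_in_def)
qed

lemma prod_decode_0: "prod_decode 0 = (0, 0)"
proof -
  have "prod_encode (0, 0) = 0" by (simp add: prod_encode_def)
  then show ?thesis by (metis prod_encode_inverse)
qed

text \<open>For \<^term>\<open>[]\<close>, whose code is 0, truncated subtraction yields the pair code 0, hence the tail \<^term>\<open>[]\<close>.\<close>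

lemma computable_in_tl [comp_intros]:
  fixes f :: "'a::encodable \<Rightarrow> 'b::encodable list"
  assumes "computable_in orc f"
  shows "computable_in orc (\<lambda>x. tl (f x))"
proof -
  have "computable_in orc (\<lambda>x. snd (prod_decode (encode (f x) - 1)))" using assms by (intro comp_intros)
  moreover have "snd (prod_decode (encode l - 1)) = encode (tl l)" for l :: "'b list"
    by (cases l) (simp_all add: prod_decode_0)
  ultimately show ?thesis by (simp add: computable_in_def)
qed

lemma computable_in_hd [comp_intros]:
  fixes f :: "'a::encodable \<Rightarrow> 'b::encodable list"
  assumes "computable_in orc f"
  shows "computable_in orc (\<lambda>x. hd (f x))"
proof -
  \<comment> \<open>\<open>hd []\<close> is unspecified but fixed, so a constant function covers the
    empty list.\<close>
  have "computable_in orc (\<lambda>x. if f x = [] then hd [] else decode (fst (prod_decode (encode (f x) - 1))))"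
    using assms by (intro comp_intros)
  also have "(\<lambda>x. if f x = [] then hd [] else decode (fst (prod_decode (encode (f x) - 1)))) = (\<lambda>x. hd (f x))"
  proof
    fix x
    show "(if f x = [] then hd [] else decode (fst (prod_decode (encode (f x) - 1)))) = hd (f x)"
      by (cases "f x") auto
  qed
  finally show ?thesis .
qed

lemma computable_in_drop [comp_intros]:
  fixes f :: "'a::encodable \<Rightarrow> 'b::encodable list"
  assumes "computable_in orc f" "computable_in orc n"
  shows "computable_in orc (\<lambda>x. drop (n x) (f x))"
proof -
  have "drop n l = rec_nat l (\<lambda>_. tl) n" for n and l :: "'b list"
    by (induction n) (auto simp: drop_Suc tl_drop[symmetric])
  moreover have "computable_in orc (\<lambda>x. rec_nat (f x) (\<lambda>_. tl) (n x))"
    using assms by (intro comp_intros)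
  ultimately show ?thesis by simp
qed

lemma computable_in_length [comp_intros]:
  fixes f :: "'a::encodable \<Rightarrow> 'b::encodable list"
  assumes "computable_in orc f"
  shows "computable_in orc (\<lambda>x. length (f x))"
proof -
  have "computable_in orc (\<lambda>x. LEAST n. drop n (f x) = [])"
    by (intro comp_intros computable_in_compose[OF assms]) auto
  moreover have "(LEAST n. drop n l = []) = length l" for l :: "'b list"
    by (rule Least_equality) auto
  ultimately show ?thesis by simp
qed

lemma computable_in_arg [comp_intros]:
  assumes "computable_in orc n" "computable_in orc f"
  shows "computable_in orc (\<lambda>x. arg (n x) (f x))"
proof -
  have "arg n l = (if n < length l then hd (drop n l) else 0)" for n l
    by (simp add: arg_def hd_drop_conv_nth)
  moreover have "computable_in orc (\<lambda>x. if n x < length (f x) then hd (drop (n x) (f x)) else 0)"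
    using assms by (intro comp_intros)
  ultimately show ?thesis by simp
qed

lemma decidable_in_bex_set [comp_intros]:
  assumes "decidable_in orc (\<lambda>q :: 'a::encodable \<times> 'b::encodable. P (fst q) (snd q))"
    and L: "computable_in orc L"
  shows "decidable_in orc (\<lambda>x. \<exists>y\<in>set (L x). P x y)"
proof -
  have "decidable_in orc (\<lambda>x. \<exists>i<length (L x). P x (hd (drop i (L x))))"
  proof (intro comp_intros L)
    show "decidable_in orc (\<lambda>q. P (fst q) (hd (drop (snd q) (L (fst q)))))"
      using decidable_in_compose[OF assms(1), of "\<lambda>q. (fst q, hd (drop (snd q) (L (fst q))))"]
      by (simp add: comp_intros computable_in_compose[OF L])
  qed
  moreover have "(\<exists>i<length (L x). P x (hd (drop i (L x)))) \<longleftrightarrow> (\<exists>y\<in>set (L x). P x y)" for x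
    by (force simp: hd_drop_conv_nth in_set_conv_nth)
  ultimately show ?thesis by simp
qed

lemma decidable_in_mem [comp_intros]:
  assumes "computable_in orc f" and L: "computable_in orc L"
  shows "decidable_in orc (\<lambda>x. f x \<in> set (L x))"
proof -
  have "decidable_in orc (\<lambda>x. \<exists>y\<in>set (L x). f x = y)"
    by (intro comp_intros L computable_in_compose[OF assms(1)])
  then show ?thesis by simp
qed

subsection \<open>Semidecidability and the enumeration theorem\<close>

text \<open>In this projection form closure under disjunction and existential quantifiers needs no
  dovetailing. \<open>semidecidable_in_program\<close> and \<open>semidecidable_in_halts\<close>
  give the equivalence with halting.\<close>

definition semidecidable_in :: "(nat \<Rightarrow> nat) \<Rightarrow> ('a::encodable \<Rightarrow> bool) \<Rightarrow> bool" where
  "semidecidable_in orc P \<longleftrightarrow>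
    (\<exists>Q. decidable_in orc (\<lambda>q :: 'a \<times> nat. Q (fst q) (snd q)) \<and> (\<forall>x. P x \<longleftrightarrow> (\<exists>n. Q x n)))"

lemma semidecidable_inI:
  assumes "decidable_in orc (\<lambda>q :: 'a::encodable \<times> nat. Q (fst q) (snd q))" "\<And>x. P x \<longleftrightarrow> (\<exists>n. Q x n)"
  shows "semidecidable_in orc P"
  using assms unfolding semidecidable_in_def by blast

lemma semidecidable_inE:
  assumes "semidecidable_in orc (P :: 'a::encodable \<Rightarrow> bool)"
  obtains Q where "decidable_in orc (\<lambda>q :: 'a \<times> nat. Q (fst q) (snd q))" "\<forall>x. P x \<longleftrightarrow> (\<exists>n. Q x n)"
  using assms unfolding semidecidable_in_def by blast

lemma semidecidable_in_decidable: "decidable_in orc P \<Longrightarrow> semidecidable_in orc P"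
  by (rule semidecidable_inI[where Q="\<lambda>x _. P x"]) (simp_all add: decidable_in_compose[OF _ computable_in_fst[OF computable_in_id]])

lemma semidecidable_in_compose:
  assumes "semidecidable_in orc P" "computable_in orc f"
  shows "semidecidable_in orc (\<lambda>x. P (f x))"
proof -
  obtain Q where Q: "decidable_in orc (\<lambda>q :: _ \<times> nat. Q (fst q) (snd q))" "\<forall>x. P x \<longleftrightarrow> (\<exists>n. Q x n)"
    by (rule semidecidable_inE[OF assms(1)])
  have "computable_in orc (\<lambda>q. (f (fst q), snd q))"
    by (intro comp_intros computable_in_compose[OF assms(2)])
  from decidable_in_compose[OF Q(1) this]
  show ?thesis by (intro semidecidable_inI[where Q="\<lambda>x n. Q (f x) n"]) (auto simp: Q(2))
qed

lemma semidecidable_in_Ex: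
  fixes P :: "'a::encodable \<Rightarrow> 'b::encodable \<Rightarrow> bool"
  assumes "semidecidable_in orc (\<lambda>q. P (fst q) (snd q))"
  shows "semidecidable_in orc (\<lambda>x. \<exists>b. P x b)"
proof -
  obtain Q where Q: "decidable_in orc (\<lambda>q :: _ \<times> nat. Q (fst q) (snd q))"
    "\<forall>q :: 'a \<times> 'b. P (fst q) (snd q) \<longleftrightarrow> (\<exists>n. Q q n)"
    by (rule semidecidable_inE[OF assms])
  \<comment> \<open>One number codes both the value of \<open>b\<close> and the witness for
    it.\<close>
  let ?b = "\<lambda>n. fst (decode n :: 'b \<times> nat)" and ?k = "\<lambda>n. snd (decode n :: 'b \<times> nat)"
  have "computable_in orc (\<lambda>q :: 'a \<times> nat. ((fst q, ?b (snd q)), ?k (snd q)))"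
    by (intro comp_intros)
  from decidable_in_compose[OF Q(1) this]
  have "decidable_in orc (\<lambda>q :: 'a \<times> nat. Q (fst q, ?b (snd q)) (?k (snd q)))"
    by simp
  moreover have "(\<exists>b. P x b) \<longleftrightarrow> (\<exists>n. Q (x, ?b n) (?k n))" for x
  proof
    assume "\<exists>b. P x b"
    then obtain b n where "Q (x, b) n" using spec[OF Q(2), of "(x, b)" for b] by auto
    then have "Q (x, ?b (encode (b, n))) (?k (encode (b, n)))" by (simp del: encode_Pair)
    then show "\<exists>n. Q (x, ?b n) (?k n)" by blast
  next
    assume "\<exists>n. Q (x, ?b n) (?k n)"
    then show "\<exists>b. P x b" using spec[OF Q(2), of "(x, b)" for b] by auto
  qed
  ultimately show ?thesis by (rule semidecidable_inI[where Q="\<lambda>x n. Q (x, ?b n) (?k n)"])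
qed

lemma semidecidable_in_disj:
  assumes "semidecidable_in orc P" "semidecidable_in orc P'"
  shows "semidecidable_in orc (\<lambda>x. P x \<or> P' x)"
proof -
  obtain Q where Q: "decidable_in orc (\<lambda>q :: _ \<times> nat. Q (fst q) (snd q))" "\<forall>x. P x \<longleftrightarrow> (\<exists>n. Q x n)"
    by (rule semidecidable_inE[OF assms(1)])
  obtain Q' where Q': "decidable_in orc (\<lambda>q :: _ \<times> nat. Q' (fst q) (snd q))" "\<forall>x. P' x \<longleftrightarrow> (\<exists>n. Q' x n)"
    by (rule semidecidable_inE[OF assms(2)])
  show ?thesis
    using decidable_in_disj[OF Q(1) Q'(1)]
    by (intro semidecidable_inI[where Q="\<lambda>x n. Q x n \<or> Q' x n"]) (auto simp: Q(2) Q'(2))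
qed

lemma semidecidable_in_conj_decidable:
  assumes "decidable_in orc P" "semidecidable_in orc P'"
  shows "semidecidable_in orc (\<lambda>x. P x \<and> P' x)"
proof -
  obtain Q' where Q': "decidable_in orc (\<lambda>q :: _ \<times> nat. Q' (fst q) (snd q))" "\<forall>x. P' x \<longleftrightarrow> (\<exists>n. Q' x n)"
    by (rule semidecidable_inE[OF assms(2)])
  show ?thesis
    using decidable_in_conj[OF decidable_in_compose[OF assms(1), of fst] Q'(1)] computable_in_fst[OF computable_in_id]
    by (intro semidecidable_inI[where Q="\<lambda>x n. P x \<and> Q' x n"]) (auto simp: Q'(2))
qed

lemma semidecidable_in_program:
  assumes "semidecidable_in orc P"
  shows "\<exists>p. \<forall>x. (\<exists>y. eval orc p [encode x] y) \<longleftrightarrow> P x"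
proof -
  obtain Q where Q: "decidable_in orc (\<lambda>q :: _ \<times> nat. Q (fst q) (snd q))" "\<forall>x. P x \<longleftrightarrow> (\<exists>n. Q x n)"
    by (rule semidecidable_inE[OF assms])
  from halting_search[OF Q(1)]
  obtain p where "\<forall>x n. eval orc p [encode x] n \<longleftrightarrow> Q x n \<and> (\<forall>m<n. \<not> Q x m)" by blast
  then have "(\<exists>n. eval orc p [encode x] n) \<longleftrightarrow> (\<exists>n. Q x n \<and> (\<forall>m<n. \<not> Q x m))" for x
    by simp
  also have "(\<exists>n. Q x n \<and> (\<forall>m<n. \<not> Q x m)) \<longleftrightarrow> P x" for x
    using exists_least_iff[of "Q x"] Q(2) by simp
  finally show ?thesis by blast
qed

section \<open>Halting certificates\<close>

type_synonym claim = "nat \<times> nat list \<times> nat"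

text \<open>Halting is certified by a list of claims (program code, arguments, value), each justified by the later
  entries.  The case numbers are those of \<^const>\<open>enc\<close>.\<close>

definition justified :: "(nat \<Rightarrow> nat) \<Rightarrow> claim list \<Rightarrow> nat \<Rightarrow> nat list \<Rightarrow> nat \<Rightarrow> bool" where
  "justified orc D c xs y \<longleftrightarrow>
    (let t = fst (prod_decode c); r = snd (prod_decode c);
         a = fst (prod_decode r); b = snd (prod_decode r) in
      t = 0 \<and> y = 0 \<or>
      t = 1 \<and> y = Suc (arg 0 xs) \<or>
      t = 2 \<and> y = arg r xs \<or>
      t = 3 \<and> (\<exists>e\<in>set D. fst e = a \<and> snd (snd e) = y \<and> length (fst (snd e)) = length (list_decode b) \<and>
                (\<forall>i<length (list_decode b). (arg i (list_decode b), xs, arg i (fst (snd e))) \<in> set D)) \<or>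
      t = 4 \<and> xs \<noteq> [] \<and>
        (if hd xs = 0 then (a, tl xs, y) \<in> set D
         else \<exists>e\<in>set D. fst e = c \<and> fst (snd e) = (hd xs - 1) # tl xs \<and>
                (b, snd (snd e) # (hd xs - 1) # tl xs, y) \<in> set D) \<or>
      t = 5 \<and> (r, y # xs, 0) \<in> set D \<and>
        (\<forall>m<y. \<exists>e\<in>set D. fst e = r \<and> fst (snd e) = m # xs \<and> snd (snd e) \<noteq> 0) \<or>
      t = 6 \<and> y = orc (arg 0 xs))"

primrec valid :: "(nat \<Rightarrow> nat) \<Rightarrow> claim list \<Rightarrow> bool" where
  "valid orc [] \<longleftrightarrow> True"
| "valid orc (j # D) \<longleftrightarrow> justified orc D (fst j) (fst (snd j)) (snd (snd j)) \<and> valid orc D"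

text \<open>The first argument is any number, program code or not, so enumerations and
  diagonalisation can range over all numbers.\<close>

definition derivable :: "(nat \<Rightarrow> nat) \<Rightarrow> nat \<Rightarrow> nat list \<Rightarrow> nat \<Rightarrow> bool" where
  "derivable orc c xs y \<longleftrightarrow> (\<exists>D. valid orc D \<and> (c, xs, y) \<in> set D)"

text \<open>Membership in \<open>D\<close> occurs only positively, so certificates may be
  concatenated.\<close>

lemma justified_mono:
  assumes "justified orc D c xs y" "set D \<subseteq> set D'"
  shows "justified orc D' c xs y"
  using assms unfolding justified_def Let_def
  by (elim disjE conjE) (simp_all split: if_splits, blast+)

lemma valid_append: "valid orc D \<Longrightarrow> valid orc D' \<Longrightarrow> valid orc (D @ D')"
  by (induction D) (auto elim: justified_mono)

lemma derivable_combine: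
  assumes "finite J" "\<And>c xs y. (c, xs, y) \<in> J \<Longrightarrow> derivable orc c xs y"
  shows "\<exists>D. valid orc D \<and> J \<subseteq> set D"
  using assms
proof (induction J rule: finite_induct)
  case empty
  show ?case by (rule exI[of _ "[]"]) simp
next
  case (insert j J)
  then obtain D where D: "valid orc D" "J \<subseteq> set D" by auto
  obtain D' where D': "valid orc D'" "j \<in> set D'"
    using insert.prems[of "fst j" "fst (snd j)" "snd (snd j)"] unfolding derivable_def by auto
  show ?case using D D' by (intro exI[of _ "D @ D'"]) (auto intro: valid_append)
qed

text \<open>Finitely many premises share one certificate, onto which the new claim is put. Each rule
  of \<open>eval\<close> becomes one use of this lemma.\<close>

lemma derivableI:
  assumes "finite J" "\<And>c xs y. (c, xs, y) \<in> J \<Longrightarrow> derivable orc c xs y"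
    and "\<And>D. J \<subseteq> set D \<Longrightarrow> justified orc D c xs y"
  shows "derivable orc c xs y"
proof -
  obtain D where "valid orc D" "J \<subseteq> set D" using derivable_combine[OF assms(1,2)] by blast
  then have "valid orc ((c, xs, y) # D)" using assms(3) by simp
  then show ?thesis unfolding derivable_def by (meson list.set_intros(1))
qed

lemma eval_imp_derivable: "eval orc p xs y \<Longrightarrow> derivable orc (enc p) xs y"
proof (induction rule: eval.induct)
  case (ev_comp xs gs zs f y)
  let ?J = "insert (enc f, zs, y) ((\<lambda>i. (enc (gs ! i), xs, zs ! i)) ` {..<length gs})"
  have len: "length gs = length zs" using ev_comp.IH(1) by (rule list_all2_lengthD)
  show ?case
  proof (rule derivableI[of ?J])
    show "derivable orc c ws v" if "(c, ws, v) \<in> ?J" for c ws v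
      using that ev_comp.IH len by (auto dest: list_all2_nthD)
    show "justified orc D (enc (Comp f gs)) xs y" if "?J \<subseteq> set D" for D
    proof -
      have "(arg i (map enc gs), xs, arg i zs) \<in> set D" if "i < length gs" for i
        using \<open>?J \<subseteq> set D\<close> that len by (auto simp: arg_def)
      moreover have "(enc f, zs, y) \<in> set D" using that by simp
      ultimately show ?thesis
        using len by (auto simp: justified_def Let_def intro!: bexI[of _ "(enc f, zs, y)"])
    qed
  qed simp
next
  case (ev_prim0 f xs y g)
  show ?case
    by (rule derivableI[of "{(enc f, xs, y)}"]) (use ev_prim0 in \<open>auto simp: justified_def Let_def\<close>)
next
  case (ev_primS f g n xs z y)
  show ?case
    by (rule derivableI[of "{(enc (Prim f g), n # xs, z), (enc g, z # n # xs, y)}"])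
      (use ev_primS.IH in \<open>auto simp: justified_def Let_def intro!: bexI[of _ "(enc (Prim f g), n # xs, z)"]\<close>)
next
  case (ev_mn f n xs)
  then obtain k where k: "\<And>m. m < n \<Longrightarrow> derivable orc (enc f) (m # xs) (Suc (k m))" by metis
  let ?J = "insert (enc f, n # xs, 0) ((\<lambda>m. (enc f, m # xs, Suc (k m))) ` {..<n})"
  show ?case
  proof (rule derivableI[of ?J])
    show "derivable orc c ws v" if "(c, ws, v) \<in> ?J" for c ws v
      using that ev_mn.IH k by auto
    show "justified orc D (enc (Mn f)) xs n" if "?J \<subseteq> set D" for D
    proof -
      have "\<exists>e\<in>set D. fst e = enc f \<and> fst (snd e) = m # xs \<and> snd (snd e) \<noteq> 0" if "m < n" for m
        using \<open>?J \<subseteq> set D\<close> that by (intro bexI[of _ "(enc f, m # xs, Suc (k m))"]) auto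
      then show ?thesis using that by (auto simp: justified_def Let_def)
    qed
  qed simp
qed (auto intro!: derivableI[of "{}"] simp: justified_def Let_def)

text \<open>Soundness of one claim, by cases mirroring the rules of \<open>eval\<close>. Claims
  contain codes of subprograms, so the hypothesis speaks of every program with the given
  code.\<close>

lemma justified_imp_eval:
  assumes IH: "\<And>c ws v q. (c, ws, v) \<in> set D \<Longrightarrow> enc q = c \<Longrightarrow> eval orc q ws v"
    and j: "justified orc D (enc p) xs y"
  shows "eval orc p xs y"
proof (cases p)
  case (Comp f gs)
  then obtain zs where zs: "(enc f, zs, y) \<in> set D" "length zs = length gs"
    "\<And>i. i < length gs \<Longrightarrow> (arg i (map enc gs), xs, arg i zs) \<in> set D"
    using j by (auto simp: justified_def Let_def)
  have "list_all2 (\<lambda>g z. eval orc g xs z) gs zs"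
    unfolding list_all2_conv_all_nth
  proof (intro conjI allI impI)
    fix i assume "i < length gs"
    with zs(3)[of i] zs(2) have "(enc (gs ! i), xs, zs ! i) \<in> set D" by (simp add: arg_def)
    then show "eval orc (gs ! i) xs (zs ! i)" using IH by blast
  qed (simp add: zs(2))
  moreover have "eval orc f zs y" using IH zs(1) by blast
  ultimately show ?thesis unfolding Comp by (rule ev_comp)
next
  case (Prim f g)
  show ?thesis
  proof (cases xs)
    case (Cons n ws)
    show ?thesis
    proof (cases n)
      case 0
      with j Prim Cons have "(enc f, ws, y) \<in> set D" by (auto simp: justified_def Let_def)
      then show ?thesis using IH 0 Prim Cons by (auto intro: ev_prim0)
    next
      case (Suc m)
      with j Prim Cons obtain z where "(enc p, m # ws, z) \<in> set D" "(enc g, z # m # ws, y) \<in> set D"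
        by (auto simp: justified_def Let_def)
      then have "eval orc (Prim f g) (m # ws) z" "eval orc g (z # m # ws) y"
        using IH Prim by blast+
      then show ?thesis unfolding Prim Cons Suc by (rule ev_primS)
    qed
  qed (use j Prim in \<open>auto simp: justified_def Let_def\<close>)
next
  case (Mn f)
  with j have n: "(enc f, y # xs, 0) \<in> set D"
    "\<forall>m<y. \<exists>e\<in>set D. fst e = enc f \<and> fst (snd e) = m # xs \<and> snd (snd e) \<noteq> 0"
    by (auto simp: justified_def Let_def)
  have "eval orc f (y # xs) 0" using IH n(1) by blast
  moreover have "\<exists>k. eval orc f (m # xs) (Suc k)" if "m < y" for m
  proof -
    from n(2) that obtain v where "(enc f, m # xs, v) \<in> set D" "v \<noteq> 0" by force
    then show ?thesis using IH by (metis not0_implies_Suc)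
  qed
  ultimately show ?thesis unfolding Mn by (intro ev_mn) auto
qed (use j in \<open>auto simp: justified_def Let_def intro: eval.intros\<close>)

lemma valid_imp_eval: "valid orc D \<Longrightarrow> (enc p, xs, y) \<in> set D \<Longrightarrow> eval orc p xs y"
proof (induction D arbitrary: p xs y)
  case (Cons j D)
  show ?case
  proof (cases "j = (enc p, xs, y)")
    case True
    with Cons.prems have "justified orc D (enc p) xs y" by simp
    then show ?thesis by (rule justified_imp_eval[rotated]) (use Cons in auto)
  qed (use Cons in auto)
qed simp

lemma derivable_iff_eval: "derivable orc (enc p) xs y \<longleftrightarrow> eval orc p xs y"
  using eval_imp_derivable valid_imp_eval unfolding derivable_def by blast

text \<open>All quantifiers in \<open>justified\<close> are bounded by a list or a number. The
  oracle \<open>orc'\<close> of the certificate may differ from \<open>orc\<close>, so oracle-free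
  certificates can be checked relative to any oracle.\<close>

lemma decidable_in_justified:
  assumes orc': "computable_in orc orc'"
    and "computable_in orc D" "computable_in orc c" "computable_in orc xs" "computable_in orc y"
  shows "decidable_in orc (\<lambda>x. justified orc' (D x) (c x) (xs x) (y x))"
  unfolding justified_def Let_def
  by (intro comp_intros assms computable_in_compose[OF orc'] computable_in_compose[OF assms(2)]
      computable_in_compose[OF assms(3)] computable_in_compose[OF assms(4)] computable_in_compose[OF assms(5)])

text \<open>Recursion over the certificate becomes a bounded quantifier over its suffixes, to which
  the closure rules apply.\<close>

lemma valid_iff_nth:
  "valid orc D \<longleftrightarrow> (\<forall>i<length D. justified orc (drop (Suc i) D) (fst (hd (drop i D)))
      (fst (snd (hd (drop i D)))) (snd (snd (hd (drop i D)))))"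
  by (induction D) (simp_all add: All_less_Suc2)

lemma decidable_in_valid:
  assumes "computable_in orc orc'" "computable_in orc D"
  shows "decidable_in orc (\<lambda>x. valid orc' (D x))"
  unfolding valid_iff_nth
  by (intro comp_intros decidable_in_justified assms computable_in_compose[OF assms(2)])

lemma semidecidable_in_derivable:
  assumes "computable_in orc orc'" "computable_in orc c" "computable_in orc xs"
  shows "semidecidable_in orc (\<lambda>x. \<exists>y. derivable orc' (c x) (xs x) y)"
  unfolding derivable_def
  by (intro semidecidable_in_Ex semidecidable_in_decidable comp_intros decidable_in_valid assms
      computable_in_compose[OF assms(2)] computable_in_compose[OF assms(3)])

lemma semidecidable_in_halts:
  assumes "computable_in orc orc'" "computable_in orc xs"
  shows "semidecidable_in orc (\<lambda>x. \<exists>y. eval orc' p (xs x) y)"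
  using semidecidable_in_derivable[OF assms(1) computable_in_const[of _ "enc p"] assms(2)]
  by (simp add: derivable_iff_eval)

section \<open>Agreement with \<open>ce\<close>, \<open>Sigma01\<close> and
  \<open>computable\<close>\<close>

lemma ce_iff: "ce A \<longleftrightarrow> semidecidable_in empty_oracle (\<lambda>x. x \<in> A)"
proof
  assume "ce A"
  then obtain p where "\<And>x. x \<in> A \<longleftrightarrow> (\<exists>y. eval empty_oracle p [x] y)" unfolding ce_def by blast
  then show "semidecidable_in empty_oracle (\<lambda>x. x \<in> A)"
    by (simp, intro semidecidable_in_halts comp_intros)
next
  assume "semidecidable_in empty_oracle (\<lambda>x. x \<in> A)"
  from semidecidable_in_program[OF this] show "ce A" unfolding ce_def by auto
qed

text \<open>\<open>Sigma01\<close> passes two arguments where semidecidability uses one coded pair;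
  composing with the pairing program converts, and determinism identifies its output.\<close>

lemma semidecidable_in_binary_program:
  fixes P :: "nat \<Rightarrow> nat \<Rightarrow> bool"
  assumes "semidecidable_in orc (\<lambda>q. P (fst q) (snd q))"
  shows "\<exists>p. \<forall>x y. (\<exists>z. eval orc p [x, y] z) \<longleftrightarrow> P x y"
proof -
  obtain p where "\<forall>q :: nat \<times> nat. (\<exists>z. eval orc p [encode q] z) \<longleftrightarrow> P (fst q) (snd q)"
    using semidecidable_in_program[OF assms] by blast
  from spec[OF this, of "(x, y)" for x y]
  have p: "(\<exists>z. eval orc p [prod_encode (x, y)] z) \<longleftrightarrow> P x y" for x y by simp
  obtain pr where pr: "computes orc pr (\<lambda>xs. prod_encode (arg 0 xs, arg 1 xs))"
    using computes_prod_encode[of orc] by (rule exE)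
  have prxy: "eval orc pr [x, y] (prod_encode (x, y))" for x y
    using pr by (auto simp: computes_def dest: spec[of _ "[x, y]"])
  have "(\<exists>z. eval orc (Comp p [pr]) [x, y] z) \<longleftrightarrow> P x y" for x y
  proof
    assume "\<exists>z. eval orc (Comp p [pr]) [x, y] z"
    then obtain z w where "eval orc pr [x, y] w" "eval orc p [w] z"
      by (auto elim!: eval_CompE simp: list_all2_Cons1)
    with prxy show "P x y" unfolding p[symmetric] using eval_deterministic by metis
  next
    assume "P x y"
    then obtain z where "eval orc p [prod_encode (x, y)] z" unfolding p[symmetric] by blast
    then have "eval orc (Comp p [pr]) [x, y] z"
      by (intro ev_comp[of _ _ _ "[prod_encode (x, y)]"]) (use prxy in auto)
    then show "\<exists>z. eval orc (Comp p [pr]) [x, y] z" by blast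
  qed
  then show ?thesis by blast
qed

lemma Sigma01_iff: "Sigma01 X R \<longleftrightarrow> semidecidable_in (chi X) (\<lambda>q. (fst q, snd q) \<in> R)"
proof
  assume "Sigma01 X R"
  then obtain p where "\<And>x y. (x, y) \<in> R \<longleftrightarrow> (\<exists>z. eval (chi X) p [x, y] z)" unfolding Sigma01_def by blast
  then show "semidecidable_in (chi X) (\<lambda>q. (fst q, snd q) \<in> R)"
    by (simp only:) (intro semidecidable_in_halts comp_intros)
next
  assume "semidecidable_in (chi X) (\<lambda>q. (fst q, snd q) \<in> R)"
  from semidecidable_in_binary_program[OF this] show "Sigma01 X R" unfolding Sigma01_def by auto
qed

lemma computable_iff: "computable f \<longleftrightarrow> computable_in empty_oracle f"
  by (simp add: computable_def computable_in_def)

lemma computable_in_empty_oracle: "computable_in orc empty_oracle"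
proof -
  have "empty_oracle = (\<lambda>_. 0)" by (auto simp: empty_oracle_def chi_def)
  then show ?thesis by (metis computable_in_const)
qed

subsection \<open>Deciding semidecidable sets from the halting set\<close>

lemma enc_inject: "enc p = enc q \<Longrightarrow> p = q"
proof (induction p arbitrary: q)
  case (Comp f gs)
  then obtain f' gs' where q: "q = Comp f' gs'" by (cases q) auto
  with Comp.prems have eq: "enc f = enc f'" "map enc gs = map enc gs'"
    by (auto dest: inj_onD[OF inj_list_encode])
  have "gs = gs'" by (rule list.inj_map_strong[OF _ eq(2)]) (rule Comp.IH(2))
  then show ?case using Comp.IH(1)[OF eq(1)] q by blast
next
  case (Prim f g)
  then obtain f' g' where q: "q = Prim f' g'" by (cases q) auto
  with Prim.prems have eq: "enc f = enc f'" "enc g = enc g'" by auto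
  show ?case using Prim.IH(1)[OF eq(1)] Prim.IH(2)[OF eq(2)] q by blast
next
  case (Mn f)
  then obtain f' where q: "q = Mn f'" by (cases q) auto
  with Mn.prems have eq: "enc f = enc f'" by auto
  show ?case using Mn.IH[OF eq] q by blast
next
  case Zero
  then show ?case by (cases q) auto
next
  case Succ
  then show ?case by (cases q) auto
next
  case (Proj i)
  then show ?case by (cases q) auto
next
  case Orc
  then show ?case by (cases q) auto
qed

primrec const_program :: "nat \<Rightarrow> recf" where
  "const_program 0 = Zero"
| "const_program (Suc n) = Comp Succ [const_program n]"

lemma eval_const_program: "eval orc (const_program n) xs y \<longleftrightarrow> y = n"
proof -
  have "eval orc (const_program n) xs n"
  proof (induction n)
    case (Suc n)
    then show ?case using ev_succ[of orc "[n]"] by (auto intro!: ev_comp[of _ _ _ "[n]"])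
  qed (auto intro: ev_zero)
  then show ?thesis using eval_deterministic by blast
qed

lemma computable_in_enc_const_program:
  assumes "computable_in orc f"
  shows "computable_in orc (\<lambda>x. enc (const_program (f x)))"
proof -
  let ?step = "\<lambda>r. prod_encode (3, prod_encode (enc Succ, Suc (prod_encode (r, 0))))"
  have "enc (const_program n) = rec_nat (enc Zero) (\<lambda>_. ?step) n" for n
    by (induction n) auto
  moreover have "computable_in orc (\<lambda>x. rec_nat (enc Zero) (\<lambda>_. ?step) (f x))"
    by (intro comp_intros assms)
  ultimately show ?thesis by simp
qed

text \<open>The s-m-n argument: \<open>?q x\<close> has the input of \<open>p\<close> built in and
  ignores its own argument, so it halts on its own code iff \<open>p\<close> halts on
  \<open>x\<close>. One query to \<open>halting_set\<close> about the computable code of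
  \<open>?q x\<close> decides \<open>P x\<close>.\<close>

lemma decidable_in_of_halting_set:
  fixes P :: "'a::encodable \<Rightarrow> bool"
  assumes X: "turing_reducible halting_set X" and "semidecidable_in empty_oracle P"
  shows "decidable_in (chi X) P"
proof -
  obtain p where p: "\<And>x. (\<exists>y. eval empty_oracle p [encode x] y) \<longleftrightarrow> P x"
    using semidecidable_in_program[OF assms(2)] by blast
  let ?q = "\<lambda>x :: 'a. Comp p [const_program (encode x)]"
  have "enc (?q x) \<in> halting_set \<longleftrightarrow> (\<exists>y. eval empty_oracle (?q x) [enc (?q x)] y)" for x
    unfolding halting_set_def using enc_inject by blast
  moreover have "(\<exists>y. eval empty_oracle (?q x) xs y) \<longleftrightarrow> (\<exists>y. eval empty_oracle p [encode x] y)" for x xs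
    by (auto elim!: eval_CompE intro!: ev_comp[of _ _ _ "[encode x]"]
        simp: list_all2_Cons1 eval_const_program)
  ultimately have q: "enc (?q x) \<in> halting_set \<longleftrightarrow> P x" for x using p by metis
  have "computable_in (chi X) (chi halting_set)"
    using X by (simp add: turing_reducible_def computable_in_def)
  moreover have "computable_in (chi X) (\<lambda>x. enc (?q x))"
    by (simp, intro comp_intros computable_in_enc_const_program)
  ultimately have *: "computable_in (chi X) (\<lambda>x. chi halting_set (enc (?q x)))"
    by (rule computable_in_compose)
  have "(\<lambda>x. chi halting_set (enc (?q x))) = (\<lambda>x. of_bool (P x))"
    by (rule ext) (simp add: chi_def q del: enc.simps)
  from *[unfolded this] show ?thesis unfolding decidable_in_def .
qed

subsection \<open>The collapsing construction\<close>

text \<open>How class numbers change when class \<open>n\<close> is merged into class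
  \<open>m < n\<close>; the shift closes the gap at \<open>n\<close>.\<close>

definition collapse :: "nat \<Rightarrow> nat \<Rightarrow> nat \<Rightarrow> nat" where
  "collapse m n k = (if k = n then m else if n < k then k - 1 else k)"

primrec apply_collapses :: "(nat \<times> nat) list \<Rightarrow> nat \<Rightarrow> nat" where
  "apply_collapses [] x = x"
| "apply_collapses (c # \<sigma>) x = collapse (fst c) (snd c) (apply_collapses \<sigma> x)"

text \<open>\<^term>\<open>T s = (e, u, v)\<close> reports that \<^term>\<open>(u, v)\<close> belongs to the \<^term>\<open>e\<close>-th relation and asks to
  merge the classes \<^term>\<open>m < n\<close> of \<^term>\<open>u\<close> and \<^term>\<open>v\<close>.  The condition \<^term>\<open>e < n\<close> is the priority ordering;
  the last conjunct says that the requirement for \<^term>\<open>e\<close> and \<^term>\<open>m\<close> is not yet satisfied.\<close>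

definition acts :: "(nat \<Rightarrow> nat \<times> nat \<times> nat) \<Rightarrow> nat \<Rightarrow> (nat \<times> nat) list \<Rightarrow> bool" where
  "acts T s \<sigma> \<longleftrightarrow>
    apply_collapses \<sigma> (fst (snd (T s))) < apply_collapses \<sigma> (snd (snd (T s))) \<and>
    fst (T s) < apply_collapses \<sigma> (snd (snd (T s))) \<and>
    \<not> (\<exists>t<s. fst (T t) = fst (T s) \<and>
          apply_collapses \<sigma> (fst (snd (T t))) = apply_collapses \<sigma> (fst (snd (T s))) \<and>
          apply_collapses \<sigma> (snd (snd (T t))) = apply_collapses \<sigma> (fst (snd (T s))))"

primrec history :: "(nat \<Rightarrow> nat \<times> nat \<times> nat) \<Rightarrow> nat \<Rightarrow> (nat \<times> nat) list" where
  "history T 0 = []"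
| "history T (Suc s) =
    (if acts T s (history T s)
     then (apply_collapses (history T s) (fst (snd (T s))), apply_collapses (history T s) (snd (snd (T s)))) # history T s
     else history T s)"

definition stage_index :: "(nat \<Rightarrow> nat \<times> nat \<times> nat) \<Rightarrow> nat \<Rightarrow> nat \<Rightarrow> nat" where
  "stage_index T s x = apply_collapses (history T s) x"

text \<open>Stage numbers never increase, so their least value is their limit.\<close>

definition limit_index :: "(nat \<Rightarrow> nat \<times> nat \<times> nat) \<Rightarrow> nat \<Rightarrow> nat" where
  "limit_index T x = (LEAST k. \<exists>s. stage_index T s x = k)"

lemma collapse_le: "m < n \<Longrightarrow> collapse m n k \<le> k"
  by (auto simp: collapse_def)

lemma collapse_below: "k < n \<Longrightarrow> collapse m n k = k"
  by (simp add: collapse_def)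

lemma surj_collapse: "m < n \<Longrightarrow> surj (collapse m n)"
proof (rule surjI)
  fix k assume "m < n"
  then show "collapse m n (if k < n then k else Suc k) = k" by (auto simp: collapse_def)
qed

section \<open>Convergence of the class numbers and satisfaction of the requirements\<close>

locale collapsing =
  fixes T :: "nat \<Rightarrow> nat \<times> nat \<times> nat"
begin

abbreviation (input) "lab s \<equiv> fst (T s)"
abbreviation (input) "lo s \<equiv> stage_index T s (fst (snd (T s)))"
abbreviation (input) "hi s \<equiv> stage_index T s (snd (snd (T s)))"
abbreviation (input) "acting s \<equiv> acts T s (history T s)"

lemma stage_index_0: "stage_index T 0 x = x"
  by (simp add: stage_index_def)

lemma stage_index_Suc:
  "stage_index T (Suc s) x =
    (if acting s then collapse (lo s) (hi s) (stage_index T s x) else stage_index T s x)"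
  by (simp add: stage_index_def)

lemma acting_iff:
  "acting s \<longleftrightarrow> lo s < hi s \<and> lab s < hi s \<and>
    \<not> (\<exists>t<s. lab t = lab s \<and> stage_index T s (fst (snd (T t))) = lo s \<and> stage_index T s (snd (snd (T t))) = lo s)"
  by (simp add: acts_def stage_index_def)

lemma antimono_stage_index: "s \<le> t \<Longrightarrow> stage_index T t x \<le> stage_index T s x"
proof (induction t rule: dec_induct)
  case (step t)
  have "stage_index T (Suc t) x \<le> stage_index T t x"
    unfolding stage_index_Suc by (auto simp: acting_iff intro: collapse_le)
  with step.IH show ?case by linarith
qed simp

lemma stage_index_eq_mono: "s \<le> t \<Longrightarrow> stage_index T s x = stage_index T s y \<Longrightarrow> stage_index T t x = stage_index T t y"
  by (induction t rule: dec_induct) (auto simp: stage_index_Suc)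

lemma surj_stage_index: "surj (stage_index T s)"
proof (induction s)
  case 0
  have "stage_index T 0 = id" by (auto simp: stage_index_0)
  then show ?case by (simp only: surj_id)
next
  case (Suc s)
  have "stage_index T (Suc s) = (if acting s then collapse (lo s) (hi s) \<circ> stage_index T s else stage_index T s)"
    by (auto simp: stage_index_Suc fun_eq_iff)
  with Suc show ?case using comp_surj[OF Suc surj_collapse] by (auto simp: acting_iff)
qed

text \<open>A merge leaves all class numbers below its \<open>hi\<close> unchanged.\<close>

lemma stage_index_stable:
  assumes "s \<le> t" "stage_index T s x = k" "\<And>r. s \<le> r \<Longrightarrow> r < t \<Longrightarrow> acting r \<Longrightarrow> k < hi r"
  shows "stage_index T t x = k"
  using assms
proof (induction t rule: dec_induct)
  case (step t)
  then show ?case by (auto simp: stage_index_Suc collapse_below)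
qed simp

lemma limit_index_le: "limit_index T x \<le> stage_index T s x"
  unfolding limit_index_def by (rule Least_le) blast

lemma eventually_limit_index: "\<exists>s. \<forall>t\<ge>s. stage_index T t x = limit_index T x"
proof -
  have "\<exists>s. stage_index T s x = limit_index T x"
    unfolding limit_index_def by (rule LeastI_ex) blast
  then obtain s where "stage_index T s x = limit_index T x" ..
  then show ?thesis using antimono_stage_index limit_index_le by (metis le_antisym)
qed

lemma limit_index_eqI: "stage_index T s x = stage_index T s y \<Longrightarrow> limit_index T x = limit_index T y"
proof -
  assume eq: "stage_index T s x = stage_index T s y"
  obtain a b where "\<forall>t\<ge>a. stage_index T t x = limit_index T x" "\<forall>t\<ge>b. stage_index T t y = limit_index T y"
    using eventually_limit_index by blast
  then have "stage_index T (max s (max a b)) x = limit_index T x" "stage_index T (max s (max a b)) y = limit_index T y"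
    by auto
  with stage_index_eq_mono[OF _ eq, of "max s (max a b)"] show ?thesis by simp
qed

lemma limit_index_eq_iff: "limit_index T x = limit_index T y \<longleftrightarrow> (\<exists>s. stage_index T s x = stage_index T s y)"
proof
  assume eq: "limit_index T x = limit_index T y"
  obtain a b where "\<forall>t\<ge>a. stage_index T t x = limit_index T x" "\<forall>t\<ge>b. stage_index T t y = limit_index T y"
    using eventually_limit_index by blast
  then have "stage_index T (max a b) x = stage_index T (max a b) y" using eq by auto
  then show "\<exists>s. stage_index T s x = stage_index T s y" ..
qed (auto intro: limit_index_eqI)

text \<open>Once the class numbers up to \<^term>\<open>k\<close> are settled, number \<^term>\<open>Suc k\<close> is dissolved at most once for each
  relation \<open>e \<le> k\<close> and each \<open>m \<le> k\<close>: the merged class keeps number \<open>m\<close>, so \<open>(e, m)\<close> stays satisfied.\<close>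

lemma finite_injury: "finite {s. acting s \<and> hi s \<le> k}"
proof (induction k)
  case 0
  have "{s. acting s \<and> hi s \<le> 0} = {}" by (auto simp: acting_iff)
  then show ?case by (simp only: finite.emptyI)
next
  case (Suc k)
  then obtain s0 where s0: "\<And>s. acting s \<Longrightarrow> s0 \<le> s \<Longrightarrow> k < hi s"
    unfolding finite_nat_set_iff_bounded by (metis (mono_tags, lifting) mem_Collect_eq not_le)
  let ?S = "{s. s0 \<le> s \<and> acting s \<and> hi s = Suc k}"
  have distinct: "(lab s, lo s) \<noteq> (lab t, lo t)" if "s \<in> ?S" "t \<in> ?S" "s < t" for s t
  proof
    assume same: "(lab s, lo s) = (lab t, lo t)"
    have lo: "lo s < hi s" "lo s \<le> k" using that(1) by (auto simp: acting_iff)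
    have "stage_index T (Suc s) (fst (snd (T s))) = lo s" "stage_index T (Suc s) (snd (snd (T s))) = lo s"
      using that(1) lo by (auto simp: stage_index_Suc collapse_def)
    moreover have "lo s < hi r" if "Suc s \<le> r" "acting r" for r
      using s0[of r] that \<open>s \<in> ?S\<close> lo by auto
    ultimately have "stage_index T t (fst (snd (T s))) = lo s" "stage_index T t (snd (snd (T s))) = lo s"
      using \<open>s < t\<close> by (auto intro!: stage_index_stable[of "Suc s" t])
    with same \<open>s < t\<close> have "\<not> acting t" by (auto simp: acting_iff)
    with that show False by simp
  qed
  have "inj_on (\<lambda>s. (lab s, lo s)) ?S"
  proof (rule inj_onI)
    fix s t assume "s \<in> ?S" "t \<in> ?S" "(lab s, lo s) = (lab t, lo t)"
    then show "s = t" using distinct[of s t] distinct[of t s] by (metis linorder_neqE_nat)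
  qed
  \<comment> \<open>Here the priority condition enters: \<open>lab s\<close> and \<open>lo s\<close>
    are both below \<open>hi s = Suc k\<close>.\<close>
  moreover have "(\<lambda>s. (lab s, lo s)) ` ?S \<subseteq> {..k} \<times> {..k}"
    by (auto simp: acting_iff)
  ultimately have "finite ?S" by (meson finite_SigmaI finite_atMost finite_subset finite_imageD)
  moreover have "{s. acting s \<and> hi s \<le> Suc k} \<subseteq> {s. acting s \<and> hi s \<le> k} \<union> ?S \<union> {..<s0}"
    by (auto simp: le_Suc_eq)
  ultimately show ?case using Suc by (meson finite_UnI finite_lessThan finite_subset)
qed

text \<open>After the last merge with \<open>hi\<close> at most \<open>k\<close>, whatever has
  number \<open>k\<close> keeps it. The stage depends on \<open>k\<close> only, not on
  \<open>x\<close>, which gives surjectivity of the limit.\<close>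

lemma eventually_index_stable: "\<exists>s. \<forall>t\<ge>s. \<forall>x. stage_index T t x = k \<longrightarrow> limit_index T x = k"
proof -
  obtain s0 where s0: "\<And>s. acting s \<Longrightarrow> s0 \<le> s \<Longrightarrow> k < hi s"
    using finite_injury[of k] unfolding finite_nat_set_iff_bounded
    by (metis (mono_tags, lifting) mem_Collect_eq not_le)
  have "limit_index T x = k" if "t \<ge> s0" "stage_index T t x = k" for t x
  proof -
    obtain s1 where "\<forall>t\<ge>s1. stage_index T t x = limit_index T x" using eventually_limit_index by blast
    moreover have "stage_index T (max t s1) x = k"
      by (rule stage_index_stable[OF _ that(2)]) (use that(1) s0 in auto)
    ultimately show ?thesis by (metis max.cobounded2)
  qed
  then show ?thesis by blast
qed

lemma surj_limit_index: "surj (limit_index T)"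
proof -
  have "\<exists>x. limit_index T x = k" for k
  proof -
    obtain s where "\<forall>x. stage_index T s x = k \<longrightarrow> limit_index T x = k"
      using eventually_index_stable by blast
    moreover obtain x where "stage_index T s x = k" using surj_stage_index by (metis surjD)
    ultimately show ?thesis by blast
  qed
  then show ?thesis by (metis surjI)
qed

text \<open>At a late stage presenting \<open>(e, u, v)\<close> the numbers of \<open>u\<close> and
  \<open>v\<close> are final, so acting is impossible: it would lower the number of
  \<open>v\<close>. By \<open>above\<close> only the last conjunct of \<open>acts\<close> can fail,
  and its witness lies in the settled class of \<open>u\<close>.\<close>

lemma requirement_met:
  assumes recurs: "\<And>s. \<exists>t\<ge>s. T t = (e, u, v)"
    and above: "max (limit_index T u) e < limit_index T v"
  shows "\<exists>u' v'. (e, u', v') \<in> range T \<and> limit_index T u' = limit_index T u \<and> limit_index T v' = limit_index T u"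
proof -
  let ?m = "limit_index T u" and ?n = "limit_index T v"
  obtain a where a: "\<forall>t\<ge>a. stage_index T t u = ?m" using eventually_limit_index by blast
  obtain b where b: "\<forall>t\<ge>b. stage_index T t v = ?n" using eventually_limit_index by blast
  obtain c where c: "\<forall>t\<ge>c. \<forall>x. stage_index T t x = ?m \<longrightarrow> limit_index T x = ?m"
    using eventually_index_stable by blast
  obtain s where s: "s \<ge> max a (max b c)" "T s = (e, u, v)" using recurs by blast
  then have su: "stage_index T s u = ?m" and sv: "stage_index T s v = ?n" "stage_index T (Suc s) v = ?n"
    using a b by auto
  have "\<not> acting s"
  proof
    assume "acting s"
    then have "stage_index T (Suc s) v = ?m" by (simp add: stage_index_Suc s(2) su sv(1) collapse_def)
    with sv above show False by simp
  qed
  then obtain t where "lab t = e" "stage_index T s (fst (snd (T t))) = ?m" "stage_index T s (snd (snd (T t))) = ?m"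
    using above by (auto simp: acting_iff s(2) su sv(1))
  moreover have "T t = (lab t, fst (snd (T t)), snd (snd (T t)))" by simp
  ultimately show ?thesis using c s(1) by (metis max.bounded_iff rangeI)
qed

end

subsection \<open>Computability of the construction\<close>

lemma rec_nat_cong_below:
  "(\<And>i r. i < n \<Longrightarrow> g i r = g' i r) \<Longrightarrow> rec_nat a g n = rec_nat a g' n"
  by (induction n) auto

text \<open>List recursion as recursion on a counter, oldest merge first. Positions are counted from
  the end, so a new head leaves earlier steps unchanged.\<close>

lemma apply_collapses_eq_rec_nat:
  "apply_collapses \<sigma> x =
    rec_nat x (\<lambda>i. collapse (fst (hd (drop (length \<sigma> - Suc i) \<sigma>))) (snd (hd (drop (length \<sigma> - Suc i) \<sigma>)))) (length \<sigma>)"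
proof (induction \<sigma>)
  case (Cons c \<sigma>)
  let ?g = "\<lambda>\<sigma> i. collapse (fst (hd (drop (length \<sigma> - Suc i) \<sigma>))) (snd (hd (drop (length \<sigma> - Suc i) \<sigma>)))"
  have "?g (c # \<sigma>) i = ?g \<sigma> i" if "i < length \<sigma>" for i
  proof -
    have "length (c # \<sigma>) - Suc i = Suc (length \<sigma> - Suc i)" using that by simp
    then show ?thesis by (simp only: drop_Suc_Cons)
  qed
  then have "rec_nat x (?g (c # \<sigma>)) (length \<sigma>) = rec_nat x (?g \<sigma>) (length \<sigma>)"
    by (intro rec_nat_cong_below) simp
  then show ?case using Cons.IH by simp
qed simp

lemma computable_in_collapse [comp_intros]:
  "computable_in orc m \<Longrightarrow> computable_in orc n \<Longrightarrow> computable_in orc k \<Longrightarrow>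
    computable_in orc (\<lambda>x. collapse (m x) (n x) (k x))"
  unfolding collapse_def by (intro comp_intros)

lemma computable_in_apply_collapses [comp_intros]:
  assumes "computable_in orc \<sigma>" "computable_in orc f"
  shows "computable_in orc (\<lambda>x. apply_collapses (\<sigma> x) (f x))"
  unfolding apply_collapses_eq_rec_nat
  by (intro comp_intros assms computable_in_compose[OF assms(1)])

lemma decidable_in_acts:
  assumes T: "computable_in orc T" and s: "computable_in orc s" and \<sigma>: "computable_in orc \<sigma>"
  shows "decidable_in orc (\<lambda>x. acts T (s x) (\<sigma> x))"
  unfolding acts_def
  by (intro comp_intros assms computable_in_compose[OF T] computable_in_compose[OF s] computable_in_compose[OF \<sigma>])

lemma computable_in_history:
  assumes T: "computable_in orc T" and s: "computable_in orc s"
  shows "computable_in orc (\<lambda>x. history T (s x))"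
proof -
  have "history T n = rec_nat [] (\<lambda>t \<sigma>. if acts T t \<sigma>
      then (apply_collapses \<sigma> (fst (snd (T t))), apply_collapses \<sigma> (snd (snd (T t)))) # \<sigma> else \<sigma>) n" for n
    by (induction n) auto
  then show ?thesis
    by (simp only:) (intro comp_intros decidable_in_acts assms computable_in_compose[OF T])
qed

lemma computable_in_stage_index:
  assumes "computable_in orc T" "computable_in orc s" "computable_in orc f"
  shows "computable_in orc (\<lambda>x. stage_index T (s x) (f x))"
  unfolding stage_index_def by (intro comp_intros computable_in_history assms)

subsection \<open>Enumerating the c.e. relations\<close>

text \<open>The last component of the decoded stage is padding, so that every triple recurs. Label 0 is reserved for
  stages without a valid certificate.\<close>

definition enumeration :: "nat \<Rightarrow> nat \<times> nat \<times> nat" where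
  "enumeration s =
    (let q = decode s :: (nat \<times> nat \<times> nat) \<times> claim list \<times> nat \<times> nat in
     if valid empty_oracle (fst (snd q)) \<and>
        (fst (fst q), [fst (snd (fst q)), snd (snd (fst q))], fst (snd (snd q))) \<in> set (fst (snd q))
     then (Suc (fst (fst q)), snd (fst q)) else (0, 0, 0))"

lemma computable_in_enumeration: "computable_in orc enumeration"
proof -
  have "computable_in orc (\<lambda>s. enumeration s)"
    unfolding enumeration_def Let_def
    by (intro comp_intros decidable_in_valid computable_in_empty_oracle)
  then show ?thesis by simp
qed

lemma enumeration_recurs: "\<exists>t\<ge>s. enumeration t = enumeration s'"
proof -
  obtain a D y k where q: "decode s' = (a :: nat \<times> nat \<times> nat, D :: claim list, y :: nat, k :: nat)"
    by (metis prod.collapse)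
  \<comment> \<open>Only the padding changes; a pair code dominates its components, so this code is
    at least \<open>s\<close>.\<close>
  let ?t = "encode (a, D, y, s)"
  have "enumeration ?t = enumeration s'"
    unfolding enumeration_def Let_def decode_encode q by simp
  moreover have "s \<le> prod_encode (encode y, encode s)" by (simp add: le_prod_encode_2)
  then have "s \<le> ?t" unfolding encode_Pair by (meson le_prod_encode_2 le_trans)
  ultimately show ?thesis by blast
qed

lemma enumeration_complete:
  assumes "semidecidable_in empty_oracle (\<lambda>q. V (fst q) (snd q))"
  shows "\<exists>e. \<forall>u v. (e, u, v) \<in> range enumeration \<longleftrightarrow> V u v"
proof -
  obtain p where p: "\<And>u v. (\<exists>y. eval empty_oracle p [u, v] y) \<longleftrightarrow> V u v"
    using semidecidable_in_binary_program[OF assms] by blast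
  have "(Suc (enc p), u, v) \<in> range enumeration \<longleftrightarrow> (\<exists>y. derivable empty_oracle (enc p) [u, v] y)" for u v
  proof
    assume "(Suc (enc p), u, v) \<in> range enumeration"
    then obtain s where s: "enumeration s = (Suc (enc p), u, v)" by (metis imageE)
    obtain e u' v' D y k where "decode s = ((e :: nat, u' :: nat, v' :: nat), D :: claim list, y :: nat, k :: nat)"
      by (metis prod.collapse)
    with s have "valid empty_oracle D" "(enc p, [u, v], y) \<in> set D"
      unfolding enumeration_def Let_def by (auto split: if_splits)
    then show "\<exists>y. derivable empty_oracle (enc p) [u, v] y" unfolding derivable_def by blast
  next
    assume "\<exists>y. derivable empty_oracle (enc p) [u, v] y"
    then obtain y D where "valid empty_oracle D" "(enc p, [u, v], y) \<in> set D"
      unfolding derivable_def by blast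
    then have "enumeration (encode ((enc p, u, v), D, y, 0 :: nat)) = (Suc (enc p), u, v)"
      unfolding enumeration_def Let_def decode_encode by simp
    then show "(Suc (enc p), u, v) \<in> range enumeration" by (metis rangeI)
  qed
  then show ?thesis using p by (auto simp: derivable_iff_eval)
qed

interpretation enum: collapsing enumeration .

definition idx_at :: "nat \<Rightarrow> nat \<Rightarrow> nat" where "idx_at = stage_index enumeration"
definition idx :: "nat \<Rightarrow> nat" where "idx = limit_index enumeration"

lemma computable_in_idx_at [comp_intros]:
  "computable_in orc s \<Longrightarrow> computable_in orc f \<Longrightarrow> computable_in orc (\<lambda>x. idx_at (s x) (f x))"
  unfolding idx_at_def by (intro computable_in_stage_index computable_in_enumeration)

lemmas idx_le = enum.limit_index_le[folded idx_def idx_at_def]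
  and eventually_idx = enum.eventually_limit_index[folded idx_def idx_at_def]
  and idx_eq_iff = enum.limit_index_eq_iff[folded idx_def idx_at_def]
  and eventually_idx_stable = enum.eventually_index_stable[folded idx_def idx_at_def]
  and surj_idx = enum.surj_limit_index[folded idx_def]

text \<open>A pair in \<open>V\<close> violating the bound recurs at arbitrarily late stages, so
  \<open>requirement_met\<close> puts a pair of \<open>V\<close> inside the class.\<close>

lemma idx_dichotomy:
  assumes "semidecidable_in empty_oracle (\<lambda>q. V (fst q) (snd q))"
  shows "\<exists>e. \<forall>m. (\<exists>u v. V u v \<and> idx u = m \<and> idx v = m) \<or> (\<forall>u v. V u v \<longrightarrow> idx u = m \<longrightarrow> idx v \<le> max m e)"
proof -
  obtain e where e: "\<And>u v. (e, u, v) \<in> range enumeration \<longleftrightarrow> V u v"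
    using enumeration_complete[OF assms] by blast
  have "\<exists>u' v'. V u' v' \<and> idx u' = idx u \<and> idx v' = idx u" if "V u v" "max (idx u) e < idx v" for u v
  proof -
    from that(1) obtain s' where "enumeration s' = (e, u, v)" unfolding e[symmetric] by auto
    then have "\<exists>t\<ge>s. enumeration t = (e, u, v)" for s using enumeration_recurs[of s s'] by simp
    from enum.requirement_met[OF this] that(2) show ?thesis unfolding idx_def e by blast
  qed
  then show ?thesis by (metis not_le)
qed

lemma semidecidable_in_idx_eq:
  assumes "computable_in orc f" "computable_in orc g"
  shows "semidecidable_in orc (\<lambda>x. idx (f x) = idx (g x))"
  unfolding idx_eq_iff
  by (intro semidecidable_in_Ex semidecidable_in_decidable comp_intros
      computable_in_compose[OF assms(1)] computable_in_compose[OF assms(2)])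

subsection \<open>Coarsening by a set of pairs\<close>

text \<open>The relation \<open>R A\<close> of the overview.\<close>

definition pair_rel :: "nat set \<Rightarrow> (nat \<times> nat) set" where
  "pair_rel A = {(x, y). idx x = idx y \<or> idx x div 2 = idx y div 2 \<and> idx x div 2 \<in> A}"

lemma equiv_pair_rel: "equiv UNIV (pair_rel A)"
  by (rule equivI) (auto simp: pair_rel_def refl_on_def sym_def trans_def)

lemma pair_rel_cong:
  "idx x = idx x' \<Longrightarrow> idx y = idx y' \<Longrightarrow> (x, y) \<in> pair_rel A \<longleftrightarrow> (x', y') \<in> pair_rel A"
  by (simp add: pair_rel_def)

lemma ex_idx: "\<exists>x. idx x = k"
  using surj_idx by (metis surjD)

text \<open>A class is one or two classes of \<open>idx\<close>, each c.e. Which case holds is one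
  bit of information about the fixed \<open>x\<close>, so \<open>A\<close> may be arbitrarily
  complex.\<close>

lemma ce_pair_rel_class: "ce (pair_rel A `` {x})"
proof -
  let ?k = "idx x div 2"
  obtain u v where uv: "idx u = 2 * ?k" "idx v = 2 * ?k + 1" using ex_idx by metis
  have "\<exists>u v. \<forall>y. y \<in> pair_rel A `` {x} \<longleftrightarrow> idx y = idx u \<or> idx y = idx v"
  proof (cases "?k \<in> A")
    case True
    have "idx y = idx u \<or> idx y = idx v \<longleftrightarrow> ?k = idx y div 2" for y
      unfolding uv by presburger
    moreover have "y \<in> pair_rel A `` {x} \<longleftrightarrow> ?k = idx y div 2" for y
      using True by (auto simp: pair_rel_def)
    ultimately show ?thesis by blast
  next
    case False
    then have "y \<in> pair_rel A `` {x} \<longleftrightarrow> idx y = idx x \<or> idx y = idx x" for y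
      by (auto simp: pair_rel_def)
    then show ?thesis by blast
  qed
  then obtain u v where "\<And>y. y \<in> pair_rel A `` {x} \<longleftrightarrow> idx y = idx u \<or> idx y = idx v" by blast
  moreover have "semidecidable_in empty_oracle (\<lambda>y. idx y = idx u \<or> idx y = idx v)"
    by (intro semidecidable_in_disj semidecidable_in_idx_eq comp_intros)
  ultimately show ?thesis by (simp add: ce_iff)
qed

lemma infinite_pair_rel_classes: "infinite (UNIV // pair_rel A)"
proof
  assume fin: "finite (UNIV // pair_rel A)"
  \<comment> \<open>Distinct even class numbers lie in different pairs, so they are never
    merged.\<close>
  define r where "r k = (SOME x. idx x = 2 * k)" for k
  have r: "idx (r k) = 2 * k" for k unfolding r_def by (rule someI_ex[OF ex_idx])
  have "inj (\<lambda>k. pair_rel A `` {r k})"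
  proof (rule injI)
    fix k l assume "pair_rel A `` {r k} = pair_rel A `` {r l}"
    then have "(r k, r l) \<in> pair_rel A"
      using eq_equiv_class_iff[OF equiv_pair_rel UNIV_I UNIV_I] by blast
    then show "k = l" by (auto simp: pair_rel_def r)
  qed
  moreover have "range (\<lambda>k. pair_rel A `` {r k}) \<subseteq> UNIV // pair_rel A"
    by (auto intro: quotientI)
  ultimately show False using fin by (meson finite_imageD finite_subset infinite_UNIV_nat)
qed

subsection \<open>Minimality\<close>

lemma computable_in_finite_support:
  fixes f :: "nat \<Rightarrow> nat"
  assumes "finite S" "\<And>x. x \<notin> S \<Longrightarrow> f x = 0"
  shows "computable_in orc f"
  using assms
proof (induction S arbitrary: f rule: finite_induct)
  case empty
  then have "f = (\<lambda>_. 0)" by auto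
  then show ?case by (metis computable_in_const)
next
  case (insert a S)
  then have "computable_in orc (f(a := 0))" by simp
  then have "computable_in orc (\<lambda>x. if x = a then f a else (f(a := 0)) x)"
    by (intro computable_in_if decidable_in_eq computable_in_id computable_in_const)
  also have "(\<lambda>x. if x = a then f a else (f(a := 0)) x) = f" by auto
  finally show ?case .
qed

lemma computable_in_mod:
  fixes n :: nat
  assumes "n > 0"
  shows "computable_in orc (\<lambda>x. x mod n)"
proof -
  have "x mod n = rec_nat 0 (\<lambda>_ r. if Suc r = n then 0 else Suc r) x" for x
    using assms by (induction x) (auto simp: mod_Suc)
  then show ?thesis by (simp only:) (intro comp_intros)
qed

lemma infinite_range_imp_section:
  fixes f :: "nat \<Rightarrow> nat"
  assumes f: "computable_in empty_oracle f" and inf: "infinite (range (\<lambda>x. idx (f x)))"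
  shows "\<exists>g. computable_in empty_oracle g \<and> (\<forall>y. idx (f (g y)) = idx y)"
proof -
  have "semidecidable_in empty_oracle (\<lambda>q :: nat \<times> nat. \<exists>x. snd q = f x)"
    by (intro semidecidable_in_Ex semidecidable_in_decidable comp_intros computable_in_compose[OF f])
  from idx_dichotomy[where V="\<lambda>u v. \<exists>x. v = f x", OF this]
  obtain e where e: "(\<exists>u v. (\<exists>x. v = f x) \<and> idx u = m \<and> idx v = m) \<or>
      (\<forall>u v. (\<exists>x. v = f x) \<longrightarrow> idx u = m \<longrightarrow> idx v \<le> max m e)" for m by blast
  \<comment> \<open>\<open>V\<close> ignores \<open>u\<close>, so any element of class
    \<open>m\<close> serves as \<open>u\<close>; the second alternative would bound the infinite
    range.\<close>
  have hit: "\<exists>x. idx (f x) = m" for m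
  proof (rule ccontr)
    assume "\<nexists>x. idx (f x) = m"
    then have "\<forall>u v. (\<exists>x. v = f x) \<longrightarrow> idx u = m \<longrightarrow> idx v \<le> max m e" using e[of m] by blast
    then have "range (\<lambda>x. idx (f x)) \<subseteq> {..max m e}" using ex_idx[of m] by auto
    with inf show False using finite_subset by blast
  qed
  \<comment> \<open>The search runs over an argument \<open>x\<close> together with a stage;
    agreement at a stage is decidable and implies agreement in the limit.\<close>
  let ?x = "\<lambda>n. fst (decode n :: nat \<times> nat)" and ?s = "\<lambda>n. snd (decode n :: nat \<times> nat)"
  let ?P = "\<lambda>y n. idx_at (?s n) (f (?x n)) = idx_at (?s n) y"
  have ex: "\<exists>n. ?P y n" for y
  proof -
    obtain x where "idx (f x) = idx y" using hit by blast
    then obtain s where "idx_at s (f x) = idx_at s y" unfolding idx_eq_iff ..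
    then have "?P y (encode (x, s))" unfolding decode_encode by simp
    then show ?thesis ..
  qed
  have "computable_in empty_oracle (\<lambda>y. ?x (LEAST n. ?P y n))"
    by (intro comp_intros computable_in_compose[OF f] ex)
  moreover have "idx (f (?x (LEAST n. ?P y n))) = idx y" for y
    using LeastI_ex[OF ex[of y]] unfolding idx_eq_iff by blast
  ultimately show ?thesis by (intro exI[of _ "\<lambda>y. ?x (LEAST n. ?P y n)"]) blast
qed

text \<open>The finitely many values have a common stage \<open>s0\<close> after which whatever
  shows such a number keeps it. From \<open>s0\<close> on, the first stage number lying in the range
  is therefore final.\<close>

lemma finite_range_imp_computable_idx:
  assumes f: "computable_in orc f" and fin: "finite (range (\<lambda>x. idx (f x)))"
  shows "computable_in orc (\<lambda>x. idx (f x))"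
proof -
  let ?M = "range (\<lambda>x. idx (f x))"
  obtain L where L: "set L = ?M" using finite_list[OF fin] by blast
  obtain b where b: "\<And>k t x. b k \<le> t \<Longrightarrow> idx_at t x = k \<Longrightarrow> idx x = k"
    using eventually_idx_stable by metis
  define s0 where "s0 = Max (b ` ?M)"
  let ?P = "\<lambda>x n. idx_at (s0 + n) (f x) \<in> set L"
  have ex: "\<exists>n. ?P x n" for x
  proof -
    obtain s where "\<forall>t\<ge>s. idx_at t (f x) = idx (f x)" using eventually_idx by blast
    then have "idx_at (s0 + s) (f x) = idx (f x)" by simp
    then show ?thesis unfolding L by (metis rangeI)
  qed
  have "computable_in orc (\<lambda>x. idx_at (s0 + (LEAST n. ?P x n)) (f x))"
    by (intro comp_intros f computable_in_compose[OF f] ex)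
  moreover have "idx_at (s0 + (LEAST n. ?P x n)) (f x) = idx (f x)" for x
  proof -
    let ?k = "idx_at (s0 + (LEAST n. ?P x n)) (f x)"
    have "?k \<in> ?M" using LeastI_ex[OF ex[of x]] L by blast
    then have "b ?k \<le> s0" unfolding s0_def using fin by (intro Max_ge) auto
    then have "idx (f x) = ?k" by (intro b[of ?k "s0 + (LEAST n. ?P x n)"]) auto
    then show ?thesis ..
  qed
  ultimately show ?thesis by simp
qed

lemma Id_mod_iff: "(x, y) \<in> Id_mod n \<longleftrightarrow> x mod n = y mod n"
proof -
  have "(x, y) \<in> Id_mod n \<longleftrightarrow> int x mod int n = int y mod int n"
    by (simp add: Id_mod_def mod_eq_dvd_iff)
  also have "\<dots> \<longleftrightarrow> x mod n = y mod n" by (simp flip: zmod_int)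
  finally show ?thesis .
qed

text \<open>The value \<open>idx (f x)\<close> determines the \<open>E\<close>-class of
  \<open>x\<close>, so there are finitely many classes, numbered by \<open>b\<close>. Finite tables
  compute the class number \<open>d x\<close> from \<open>idx (f x)\<close> and choose
  representatives \<open>r i\<close>.\<close>

lemma finite_range_imp_Id_mod:
  fixes f :: "nat \<Rightarrow> nat"
  assumes E: "equiv UNIV E" and f: "computable_in empty_oracle f"
    and idx_E: "\<And>x y. idx (f x) = idx (f y) \<Longrightarrow> (x, y) \<in> E"
    and fin: "finite (range (\<lambda>x. idx (f x)))"
  shows "\<exists>n\<ge>1. cequiv E (Id_mod n)"
proof -
  let ?M = "range (\<lambda>x. idx (f x))"
  define G where "G k = E `` {SOME x. idx (f x) = k}" for k
  have G: "E `` {x} = G (idx (f x))" for x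
    unfolding G_def using idx_E someI[of "\<lambda>z. idx (f z) = idx (f x)" x] E
    by (intro equiv_class_eq) (auto simp: eq_commute)
  have "UNIV // E \<subseteq> G ` ?M" unfolding quotient_def using G by auto
  then have finE: "finite (UNIV // E)" using fin finite_subset by blast
  let ?n = "card (UNIV // E)"
  have n: "?n \<ge> 1" using finE by (metis One_nat_def Suc_leI UNIV_I card_gt_0_iff empty_iff quotientI)
  obtain b where b: "bij_betw b (UNIV // E) {0..<?n}" using ex_bij_betw_finite_nat[OF finE] by blast
  define d where "d x = b (E `` {x})" for x
  have d_less: "d x < ?n" for x
    using b unfolding d_def by (metis UNIV_I atLeastLessThan_iff bij_betwE quotientI)
  have d_eq: "d x = d y \<longleftrightarrow> (x, y) \<in> E" for x y
  proof -
    have "d x = d y \<longleftrightarrow> E `` {x} = E `` {y}"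
      unfolding d_def using b by (metis UNIV_I bij_betw_imp_inj_on inj_on_def quotientI)
    then show ?thesis using eq_equiv_class_iff[OF E UNIV_I UNIV_I] by blast
  qed
  have "computable_in empty_oracle (\<lambda>k. if k \<in> ?M then b (G k) else 0)"
    using fin by (rule computable_in_finite_support) auto
  from computable_in_compose[OF this finite_range_imp_computable_idx[OF f fin]]
  have d: "computable_in empty_oracle d" by (simp add: G[symmetric] d_def[symmetric])
  define r where "r i = (if i < ?n then SOME x. d x = i else 0)" for i
  have r: "d (r i) = i" if "i < ?n" for i
  proof -
    have "i \<in> b ` (UNIV // E)" using b that by (simp add: bij_betw_def)
    then have "\<exists>x. d x = i" unfolding d_def quotient_def by auto
    from someI_ex[OF this] show ?thesis using that by (simp add: r_def)
  qed
  have "computable_in empty_oracle r"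
    by (rule computable_in_finite_support[of "{..<?n}"]) (auto simp: r_def)
  then have r_mod: "computable_in empty_oracle (\<lambda>x. r (x mod ?n))"
    by (rule computable_in_compose) (use n in \<open>simp add: computable_in_mod\<close>)
  have "creduc E (Id_mod ?n)"
    unfolding creduc_def computable_iff
    using d d_eq d_less by (intro exI[of _ d]) (simp add: Id_mod_iff)
  moreover have "creduc (Id_mod ?n) E"
    unfolding creduc_def computable_iff
    using r_mod n by (intro exI[of _ "\<lambda>x. r (x mod ?n)"]) (simp add: Id_mod_iff d_eq[symmetric] r)
  ultimately show ?thesis using n unfolding cequiv_def by blast
qed

lemma minimal_pair_rel: "minimal_er (pair_rel A)"
  unfolding minimal_er_def
proof (intro conjI allI impI infinite_pair_rel_classes)
  fix E assume E: "equiv UNIV E" and red: "creduc E (pair_rel A)"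
  then obtain f where f: "computable_in empty_oracle f"
    and fE: "\<And>x y. (x, y) \<in> E \<longleftrightarrow> (f x, f y) \<in> pair_rel A"
    unfolding creduc_def computable_iff by blast
  show "cequiv E (pair_rel A) \<or> (\<exists>n\<ge>1. cequiv E (Id_mod n))"
  proof (cases "finite (range (\<lambda>x. idx (f x)))")
    case True
    then show ?thesis
      using finite_range_imp_Id_mod[OF E f] by (auto simp: fE pair_rel_def)
  next
    case False
    then obtain g where g: "computable_in empty_oracle g" "\<And>y. idx (f (g y)) = idx y"
      using infinite_range_imp_section[OF f] by blast
    \<comment> \<open>\<open>g\<close> inverts \<open>f\<close> up to \<open>idx\<close>, and
      \<open>pair_rel A\<close> depends on \<open>idx\<close> only.\<close>
    have "(y, y') \<in> pair_rel A \<longleftrightarrow> (g y, g y') \<in> E" for y y'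
      unfolding fE by (rule pair_rel_cong) (simp_all add: g(2))
    then have "creduc (pair_rel A) E"
      unfolding creduc_def computable_iff using g(1) by blast
    then show ?thesis using red by (simp add: cequiv_def)
  qed
qed

subsection \<open>Incomparability\<close>

text \<open>The dichotomy, applied to the graph of a reduction and to its converse, forces the reduction to fix almost
  every class up to its partner.\<close>

lemma creduc_pair_rel_imp_almost_subset:
  assumes "creduc (pair_rel A) (pair_rel B)"
  shows "finite (B - A)"
proof -
  obtain f where f: "computable_in empty_oracle f"
    and fR: "\<And>x y. (x, y) \<in> pair_rel A \<longleftrightarrow> (f x, f y) \<in> pair_rel B"
    using assms unfolding creduc_def computable_iff by blast
  have "semidecidable_in empty_oracle (\<lambda>q. snd q = f (fst q))"
    by (intro semidecidable_in_decidable comp_intros computable_in_compose[OF f])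
  from idx_dichotomy[where V="\<lambda>u v. v = f u", OF this]
  obtain e1 where up: "(\<exists>u v. v = f u \<and> idx u = m \<and> idx v = m) \<or>
      (\<forall>u v. v = f u \<longrightarrow> idx u = m \<longrightarrow> idx v \<le> max m e1)" for m by blast
  have "semidecidable_in empty_oracle (\<lambda>q. fst q = f (snd q))"
    by (intro semidecidable_in_decidable comp_intros computable_in_compose[OF f])
  from idx_dichotomy[where V="\<lambda>u v. u = f v", OF this]
  obtain e2 where down: "(\<exists>u v. u = f v \<and> idx u = m \<and> idx v = m) \<or>
      (\<forall>u v. u = f v \<longrightarrow> idx u = m \<longrightarrow> idx v \<le> max m e2)" for m by blast
  have fixed: "idx (f x) div 2 = j" if x: "idx x div 2 = j" "max e1 e2 < idx x" and j: "j \<notin> A" for x j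
  proof (rule linorder_cases[of "idx (f x)" "idx x"])
    \<comment> \<open>This case is contradictory: \<open>down\<close> yields \<open>v\<close> in the
      class of \<open>f x\<close> with \<open>f v\<close> there too, hence \<open>v\<close> related
      to \<open>x\<close>, although \<open>j \<notin> A\<close> and their classes differ.\<close>
    assume less: "idx (f x) < idx x"
    then have "\<not> idx x \<le> max (idx (f x)) e2" using x(2) by (simp add: not_le)
    then obtain v where v: "idx (f v) = idx (f x)" "idx v = idx (f x)"
      using down[of "idx (f x)"] by blast
    then have "(v, x) \<in> pair_rel A" unfolding fR by (simp add: pair_rel_def)
    then show ?thesis using v less x j by (auto simp: pair_rel_def)
  next
    assume "idx (f x) = idx x"
    then show ?thesis using x by simp
  next
    \<comment> \<open>Now \<open>up\<close> yields \<open>u\<close> in the class of \<open>x\<close>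
      with \<open>f u\<close> there too; as \<open>f u\<close> and \<open>f x\<close> are related,
      \<open>f x\<close> can only lie in the partner class.\<close>
    assume greater: "idx x < idx (f x)"
    then have "\<not> idx (f x) \<le> max (idx x) e1" using x(2) by (simp add: not_le)
    then obtain u where u: "idx u = idx x" "idx (f u) = idx x"
      using up[of "idx x"] by blast
    then have "(u, x) \<in> pair_rel A" by (simp add: pair_rel_def)
    then have "(f u, f x) \<in> pair_rel B" by (simp add: fR)
    then show ?thesis using u greater x by (auto simp: pair_rel_def)
  qed
  have "2 * j \<le> max e1 e2" if "j \<in> B" "j \<notin> A" for j
  proof (rule ccontr)
    assume large: "\<not> 2 * j \<le> max e1 e2"
    \<comment> \<open>Both halves of pair \<open>j\<close> are mapped into pair \<open>j\<close>,
      which \<open>B\<close> merges but \<open>A\<close> keeps apart.\<close>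
    obtain x y where xy: "idx x = 2 * j" "idx y = 2 * j + 1" using ex_idx by metis
    then have "idx (f x) div 2 = j" "idx (f y) div 2 = j"
      using fixed[of x j] fixed[of y j] large \<open>j \<notin> A\<close> by (auto simp: not_le)
    then have "(x, y) \<in> pair_rel A" unfolding fR using \<open>j \<in> B\<close> by (simp add: pair_rel_def)
    then show False using xy \<open>j \<notin> A\<close> by (simp add: pair_rel_def)
  qed
  then have "B - A \<subseteq> {..max e1 e2}" by fastforce
  then show ?thesis using finite_subset by blast
qed

subsection \<open>Complexity relative to the oracle\<close>

lemma computable_in_div2 [comp_intros]:
  fixes f :: "_ \<Rightarrow> nat"
  assumes "computable_in orc f"
  shows "computable_in orc (\<lambda>x. f x div 2)"
proof -
  \<comment> \<open>The quotient is the least \<open>q\<close> with \<open>n < 2 * (q + 1)\<close>,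
    written with sums to match the closure rules.\<close>
  have "computable_in orc (\<lambda>x. LEAST q. f x < q + q + 2)"
    by (intro comp_intros computable_in_compose[OF assms]) presburger
  moreover have "(LEAST q. n < q + q + 2) = n div 2" for n :: nat
    by (rule Least_equality) presburger+
  ultimately show ?thesis by simp
qed

context
  fixes X :: "nat set"
  assumes X: "turing_reducible halting_set X"
begin

text \<open>\<open>idx x \<le> k\<close> holds iff some stage number is at most \<open>k\<close>, a
  c.e. condition, so \<open>X\<close> decides it and finds the least such \<open>k\<close>.\<close>

lemma computable_in_idx:
  assumes "computable_in (chi X) f"
  shows "computable_in (chi X) (\<lambda>x. idx (f x))"
proof -
  have "semidecidable_in empty_oracle (\<lambda>q. \<exists>s. idx_at s (fst q) \<le> snd q)"
    by (intro semidecidable_in_Ex semidecidable_in_decidable comp_intros)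
  from decidable_in_of_halting_set[OF X this]
  have "decidable_in (chi X) (\<lambda>q. \<exists>s. idx_at s (fst q) \<le> snd q)" .
  then have "computable_in (chi X) (\<lambda>x. LEAST k. \<exists>s. idx_at s x \<le> k)"
    by (rule computable_in_Least) auto
  moreover have "(LEAST k. \<exists>s. idx_at s x \<le> k) = idx x" for x
  proof (rule Least_equality)
    obtain s where "\<forall>t\<ge>s. idx_at t x = idx x" using eventually_idx by blast
    then show "\<exists>s. idx_at s x \<le> idx x" by (metis order_refl)
    show "idx x \<le> k" if "\<exists>s. idx_at s x \<le> k" for k using that idx_le le_trans by blast
  qed
  ultimately have "computable_in (chi X) idx" by simp
  then show ?thesis using assms by (rule computable_in_compose)
qed

lemma Sigma01_pair_rel_iff: "Sigma01 X (pair_rel A) \<longleftrightarrow> semidecidable_in (chi X) (\<lambda>k. k \<in> A)"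
  and Pi01_pair_rel_iff: "Pi01 X (pair_rel A) \<longleftrightarrow> semidecidable_in (chi X) (\<lambda>k. k \<notin> A)"
proof -
  \<comment> \<open>Representatives of the classes, computable in \<open>X\<close>. The pair for
    \<open>2 k\<close> and \<open>2 k + 1\<close> reduces \<open>A\<close> to the relation;
    conversely \<open>idx\<close> reduces the relation to \<open>A\<close>.\<close>
  let ?r = "\<lambda>k. LEAST x. idx x = k"
  have idx_r: "idx (?r k) = k" for k using LeastI_ex[OF ex_idx] .
  have r: "computable_in (chi X) (\<lambda>k. (?r (k + k), ?r (Suc (k + k))))"
    by (intro comp_intros computable_in_idx ex_idx)
  have in_A: "(?r (k + k), ?r (Suc (k + k))) \<in> pair_rel A \<longleftrightarrow> k \<in> A" for k
    by (auto simp: pair_rel_def idx_r)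
  have decidable: "decidable_in (chi X) (\<lambda>q. idx (fst q) = idx (snd q))"
      "decidable_in (chi X) (\<lambda>q. idx (fst q) div 2 = idx (snd q) div 2)"
      "decidable_in (chi X) (\<lambda>q. idx (fst q) \<noteq> idx (snd q))"
      "decidable_in (chi X) (\<lambda>q. idx (fst q) div 2 \<noteq> idx (snd q) div 2)"
    by (intro comp_intros computable_in_idx)+
  have half: "computable_in (chi X) (\<lambda>q :: nat \<times> nat. idx (fst q) div 2)"
    by (intro comp_intros computable_in_idx)
  show "Sigma01 X (pair_rel A) \<longleftrightarrow> semidecidable_in (chi X) (\<lambda>k. k \<in> A)"
  proof
    assume "Sigma01 X (pair_rel A)"
    from semidecidable_in_compose[OF this[unfolded Sigma01_iff] r]
    show "semidecidable_in (chi X) (\<lambda>k. k \<in> A)" by (simp add: in_A)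
  next
    assume A: "semidecidable_in (chi X) (\<lambda>k. k \<in> A)"
    have "semidecidable_in (chi X) (\<lambda>q. idx (fst q) = idx (snd q) \<or>
        idx (fst q) div 2 = idx (snd q) div 2 \<and> idx (fst q) div 2 \<in> A)"
      by (intro semidecidable_in_disj semidecidable_in_conj_decidable decidable
          semidecidable_in_decidable[OF decidable(1)] semidecidable_in_compose[OF A half])
    then show "Sigma01 X (pair_rel A)" by (simp add: Sigma01_iff pair_rel_def case_prod_unfold)
  qed
  show "Pi01 X (pair_rel A) \<longleftrightarrow> semidecidable_in (chi X) (\<lambda>k. k \<notin> A)"
  proof
    assume "Pi01 X (pair_rel A)"
    from semidecidable_in_compose[OF this[unfolded Pi01_def Sigma01_iff] r]
    show "semidecidable_in (chi X) (\<lambda>k. k \<notin> A)" by (simp add: in_A)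
  next
    assume A: "semidecidable_in (chi X) (\<lambda>k. k \<notin> A)"
    have "semidecidable_in (chi X) (\<lambda>q. idx (fst q) \<noteq> idx (snd q) \<and>
        (idx (fst q) div 2 \<noteq> idx (snd q) div 2 \<or> idx (fst q) div 2 \<notin> A))"
      by (intro semidecidable_in_disj semidecidable_in_conj_decidable decidable
          semidecidable_in_decidable[OF decidable(4)] semidecidable_in_compose[OF A half])
    then show "Pi01 X (pair_rel A)" by (simp add: Pi01_def Sigma01_iff pair_rel_def case_prod_unfold)
  qed
qed

end

section \<open>The halting problem relative to an oracle and its disjoint copies\<close>

definition self_halting :: "(nat \<Rightarrow> nat) \<Rightarrow> nat set" where
  "self_halting orc = {n. \<exists>y. derivable orc n [n] y}"

lemma semidecidable_in_self_halting: "semidecidable_in orc (\<lambda>n. n \<in> self_halting orc)"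
proof -
  have "computable_in orc orc" using computable_in_orc[OF computable_in_id] .
  then show ?thesis
    unfolding self_halting_def mem_Collect_eq by (intro semidecidable_in_derivable comp_intros)
qed

lemma not_semidecidable_in_compl_self_halting: "\<not> semidecidable_in orc (\<lambda>n. n \<notin> self_halting orc)"
proof
  assume "semidecidable_in orc (\<lambda>n. n \<notin> self_halting orc)"
  from semidecidable_in_program[OF this]
  obtain p where "\<And>n. (\<exists>y. eval orc p [n] y) \<longleftrightarrow> n \<notin> self_halting orc" by auto
  from this[of "enc p"] show False unfolding self_halting_def mem_Collect_eq derivable_iff_eval by blast
qed

text \<open>The elements code triples \<open>(i, n, r)\<close> with \<open>n\<close> in
  \<open>K\<close>. The free \<open>r\<close> makes a column infinite as soon as \<open>K\<close>
  has one element, as needed against finite differences.\<close>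

definition column :: "nat set \<Rightarrow> nat \<Rightarrow> nat set" where
  "column K i = {z. fst (prod_decode z) = i \<and> fst (prod_decode (snd (prod_decode z))) \<in> K}"

lemma semidecidable_in_column:
  assumes "semidecidable_in orc (\<lambda>n. n \<in> K)"
  shows "semidecidable_in orc (\<lambda>z. z \<in> column K i)"
  unfolding column_def mem_Collect_eq
  by (intro semidecidable_in_conj_decidable semidecidable_in_compose[OF assms] comp_intros)

lemma semidecidable_in_compl_column:
  assumes "semidecidable_in orc (\<lambda>z. z \<notin> column K i)"
  shows "semidecidable_in orc (\<lambda>n. n \<notin> K)"
proof -
  have "computable_in orc (\<lambda>n. prod_encode (i, prod_encode (n, 0)))" by (intro comp_intros)
  from semidecidable_in_compose[OF assms this] show ?thesis by (simp add: column_def)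
qed

lemma infinite_column_diff:
  assumes "K \<noteq> {}" "i \<noteq> j"
  shows "infinite (column K i - column K j)"
proof -
  obtain n where "n \<in> K" using assms(1) by blast
  then have "range (\<lambda>r. prod_encode (i, prod_encode (n, r))) \<subseteq> column K i - column K j"
    using assms(2) by (auto simp: column_def)
  moreover have "inj (\<lambda>r. prod_encode (i, prod_encode (n, r)))" by (rule injI) simp
  ultimately show ?thesis by (meson finite_imageD finite_subset infinite_UNIV_nat)
qed

theorem theorem1:
  fixes X :: "nat set"
  assumes "turing_reducible halting_set X"
  shows "\<exists>(E :: nat \<Rightarrow> (nat \<times> nat) set) (F :: nat \<Rightarrow> (nat \<times> nat) set).
     (\<forall>i. equiv UNIV (E i) \<and> minimal_er (E i) \<and> Sigma01 X (E i) \<and> \<not> Pi01 X (E i)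
          \<and> (\<forall>x. ce (E i `` {x}))) \<and>
     (\<forall>i j. i \<noteq> j \<longrightarrow> \<not> creduc (E i) (E j)) \<and>
     (\<forall>i. equiv UNIV (F i) \<and> minimal_er (F i) \<and> Pi01 X (F i) \<and> \<not> Sigma01 X (F i)
          \<and> (\<forall>x. ce (F i `` {x}))) \<and>
     (\<forall>i j. i \<noteq> j \<longrightarrow> \<not> creduc (F i) (F j))"
proof -
  define K where "K = self_halting (chi X)"
  have K: "semidecidable_in (chi X) (\<lambda>n. n \<in> K)" "\<not> semidecidable_in (chi X) (\<lambda>n. n \<notin> K)"
    unfolding K_def by (rule semidecidable_in_self_halting not_semidecidable_in_compl_self_halting)+
  \<comment> \<open>Otherwise the complement of \<open>K\<close> would be decidable.\<close>
  have "K \<noteq> {}"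
    using K(2) semidecidable_in_decidable[OF decidable_in_const[of "chi X" True]] by auto
  have sem: "semidecidable_in (chi X) (\<lambda>z. z \<in> column K i)"
      "\<not> semidecidable_in (chi X) (\<lambda>z. z \<notin> column K i)" for i
    using semidecidable_in_column semidecidable_in_compl_column K by blast+
  have E_inc: "\<not> creduc (pair_rel (column K i)) (pair_rel (column K j))" if "i \<noteq> j" for i j
    using creduc_pair_rel_imp_almost_subset[of "column K i" "column K j"]
      infinite_column_diff[OF \<open>K \<noteq> {}\<close> that[symmetric]] by blast
  \<comment> \<open>Complementing reverses the difference: \<open>column K i - column K j\<close>
    must be infinite now, in place of \<open>column K j - column K i\<close>.\<close>
  have F_inc: "\<not> creduc (pair_rel (- column K i)) (pair_rel (- column K j))" if "i \<noteq> j" for i j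
    using creduc_pair_rel_imp_almost_subset[of "- column K i" "- column K j"]
      infinite_column_diff[OF \<open>K \<noteq> {}\<close> that] by (auto simp: Diff_eq Int_commute)
  show ?thesis
    by (rule exI[of _ "\<lambda>i. pair_rel (column K i)"], rule exI[of _ "\<lambda>i. pair_rel (- column K i)"])
      (use E_inc F_inc sem in \<open>simp add: equiv_pair_rel minimal_pair_rel ce_pair_rel_class
        Sigma01_pair_rel_iff[OF assms] Pi01_pair_rel_iff[OF assms]\<close>)
qed

end
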